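(* Let $n\ge 2$, let $\mathcal{M}^n$ be the set of all (orientation preserving diffeomorphism types of) connected smooth oriented $n$-manifolds without boundary, compact or not, and let $V$ be a vector space or an abelian group. There does not exist a nontrivial (i.e. not identically zero) map $c:\mathcal{M}^n\to V$ such that (1) if $M$ and $M'$ are orientation preserving diffeomorphic, then $c(M)=c(M')$; and (2) $c(M\# M')=c(M)+c(M')$ for all $M,M'\in\mathcal{M}^n$.
   Context: $M\# M'$ denotes the oriented connected sum of two connected oriented smooth $n$-manifolds. *)

theory Defs
  imports "HOL-Analysis.Analysis"
begin

section \<open>Smooth maps between open subsets of Euclidean spaces\<close>

text \<open>The definitions are meant for open \<open>S\<close>. In finite dimension a map is of class
  \<open>C\<^sup>k\<^sup>+\<^sup>1\<close> iff it is differentiable and all its directional derivatives are of class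
  \<open>C\<^sup>k\<close>.\<close>

primrec Ck_on :: "nat \<Rightarrow> (real^'n) set \<Rightarrow> (real^'n \<Rightarrow> real^'m) \<Rightarrow> bool" where
  "Ck_on 0 S f \<longleftrightarrow> continuous_on S f"
| "Ck_on (Suc k) S f \<longleftrightarrow>
     (\<forall>x\<in>S. f differentiable (at x)) \<and>
     (\<forall>v. Ck_on k S (\<lambda>x. frechet_derivative f (at x) v))"

definition smooth_on :: "(real^'n) set \<Rightarrow> (real^'n \<Rightarrow> real^'m) \<Rightarrow> bool" where
  "smooth_on S f \<longleftrightarrow> (\<forall>k. Ck_on k S f)"

definition jacobian_det :: "(real^'n \<Rightarrow> real^'n) \<Rightarrow> real^'n \<Rightarrow> real" where
  "jacobian_det f x = det (matrix (frechet_derivative f (at x)))"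


section \<open>Oriented smooth manifolds without boundary\<close>

text \<open>A chart \<open>(U, \<phi>)\<close> consists of its domain and a function of which only the
  restriction to \<open>U\<close> is relevant.\<close>

type_synonym ('a, 'n) chart = "'a set \<times> ('a \<Rightarrow> real^'n)"

record ('a, 'n) atlas_space =
  mtop :: "'a topology"
  atlas :: "('a, 'n) chart set"

definition is_chart :: "'a topology \<Rightarrow> ('a, 'n::finite) chart \<Rightarrow> bool" where
  "is_chart T = (\<lambda>(U, \<phi>). openin T U \<and> open (\<phi> ` U) \<and>
     homeomorphic_map (subtopology T U) (top_of_set (\<phi> ` U)) \<phi>)"

text \<open>The expression \<open>\<psi> \<circ> f \<circ> \<phi>\<^sup>-\<^sup>1\<close> of \<open>f\<close> in the charts \<open>(U, \<phi>)\<close> and \<open>(V, \<psi>)\<close>,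
  and the set \<open>\<phi>(U \<inter> f\<^sup>-\<^sup>1(V))\<close> on which it is meaningful. For \<open>f = id\<close> this is the
  transition map between the two charts.\<close>

definition loc_rep ::
  "('a \<Rightarrow> 'b) \<Rightarrow> ('a, 'n::finite) chart \<Rightarrow> ('b, 'n) chart \<Rightarrow> real^'n \<Rightarrow> real^'n" where
  "loc_rep f = (\<lambda>(U, \<phi>) (V, \<psi>). \<psi> \<circ> f \<circ> inv_into U \<phi>)"

definition loc_dom ::
  "('a \<Rightarrow> 'b) \<Rightarrow> ('a, 'n::finite) chart \<Rightarrow> ('b, 'n) chart \<Rightarrow> (real^'n) set" where
  "loc_dom f = (\<lambda>(U, \<phi>) (V, \<psi>). \<phi> ` (U \<inter> f -` V))"

text \<open>The atlas is not required to be maximal: all notions below depend only on the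
  oriented smooth structure it generates, and compatible atlases are related by the
  identity, which is then an orientation preserving diffeomorphism.\<close>

definition oriented_smooth_manifold :: "('a, 'n::finite) atlas_space \<Rightarrow> bool" where
  "oriented_smooth_manifold M \<longleftrightarrow>
     Hausdorff_space (mtop M) \<and> second_countable (mtop M) \<and>
     (\<forall>\<kappa>\<in>atlas M. is_chart (mtop M) \<kappa>) \<and>
     (\<Union>\<kappa>\<in>atlas M. fst \<kappa>) = topspace (mtop M) \<and>
     (\<forall>\<kappa>\<in>atlas M. \<forall>\<mu>\<in>atlas M.
        smooth_on (loc_dom id \<kappa> \<mu>) (loc_rep id \<kappa> \<mu>) \<and>
        (\<forall>x\<in>loc_dom id \<kappa> \<mu>. jacobian_det (loc_rep id \<kappa> \<mu>) x > 0))"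

text \<open>The connected oriented smooth manifolds without boundary, of dimension
  \<open>CARD('n)\<close>, whose points are taken from the type \<open>'a\<close>. A connected manifold is nonempty.
  Every (second countable) manifold has at most continuum many points; hence if \<open>'a\<close>
  has at least continuum many elements, e.g. if \<open>'a\<close> is \<open>real\<close>, all diffeomorphism
  types are represented. For a smaller type \<open>'a\<close> the set is empty in positive dimension.\<close>

definition connected_oriented_manifolds :: "('a, 'n::finite) atlas_space set" where
  "connected_oriented_manifolds =
     {M. oriented_smooth_manifold M \<and> connected_space (mtop M) \<and> topspace (mtop M) \<noteq> {}}"


section \<open>Diffeomorphisms\<close>

definition smooth_map ::
  "('a, 'n::finite) atlas_space \<Rightarrow> ('b, 'n) atlas_space \<Rightarrow> ('a \<Rightarrow> 'b) \<Rightarrow> bool" where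
  "smooth_map M N f \<longleftrightarrow> continuous_map (mtop M) (mtop N) f \<and>
     (\<forall>\<kappa>\<in>atlas M. \<forall>\<mu>\<in>atlas N. smooth_on (loc_dom f \<kappa> \<mu>) (loc_rep f \<kappa> \<mu>))"

definition diffeomorphism ::
  "('a, 'n::finite) atlas_space \<Rightarrow> ('b, 'n) atlas_space \<Rightarrow> ('a \<Rightarrow> 'b) \<Rightarrow> bool" where
  "diffeomorphism M N f \<longleftrightarrow>
     (\<exists>g. homeomorphic_maps (mtop M) (mtop N) f g \<and> smooth_map M N f \<and> smooth_map N M g)"

definition orientation_preserving ::
  "('a, 'n::finite) atlas_space \<Rightarrow> ('b, 'n) atlas_space \<Rightarrow> ('a \<Rightarrow> 'b) \<Rightarrow> bool" where
  "orientation_preserving M N f \<longleftrightarrow>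
     (\<forall>\<kappa>\<in>atlas M. \<forall>\<mu>\<in>atlas N. \<forall>x\<in>loc_dom f \<kappa> \<mu>. jacobian_det (loc_rep f \<kappa> \<mu>) x > 0)"

definition orientation_reversing ::
  "('a, 'n::finite) atlas_space \<Rightarrow> ('b, 'n) atlas_space \<Rightarrow> ('a \<Rightarrow> 'b) \<Rightarrow> bool" where
  "orientation_reversing M N f \<longleftrightarrow>
     (\<forall>\<kappa>\<in>atlas M. \<forall>\<mu>\<in>atlas N. \<forall>x\<in>loc_dom f \<kappa> \<mu>. jacobian_det (loc_rep f \<kappa> \<mu>) x < 0)"

definition oriented_diffeomorphic ::
  "('a, 'n::finite) atlas_space \<Rightarrow> ('b, 'n) atlas_space \<Rightarrow> bool" where
  "oriented_diffeomorphic M N \<longleftrightarrow>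
     (\<exists>f. diffeomorphism M N f \<and> orientation_preserving M N f)"


section \<open>Connected sums\<close>

definition euclidean_piece :: "(real^'n::finite) set \<Rightarrow> (real^'n, 'n) atlas_space" where
  "euclidean_piece U = \<lparr>mtop = top_of_set U, atlas = {(U, id)}\<rparr>"

definition open_submanifold ::
  "('a, 'n::finite) atlas_space \<Rightarrow> 'a set \<Rightarrow> ('a, 'n) atlas_space" where
  "open_submanifold M W =
     \<lparr>mtop = subtopology (mtop M) W, atlas = (\<lambda>(U, \<phi>). (U \<inter> W, \<phi>)) ` atlas M\<rparr>"

text \<open>Smooth embeddings \<open>D\<^sup>n \<rightarrow> M\<close> of the closed unit disc. Smoothness on the closed disc
  means that the embedding extends to an open neighbourhood of the disc. In
  codimension zero, an embedding of an open set is a diffeomorphism onto an open subset.\<close>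

definition orientation_preserving_disc ::
  "('a, 'n::finite) atlas_space \<Rightarrow> (real^'n \<Rightarrow> 'a) \<Rightarrow> bool" where
  "orientation_preserving_disc M i \<longleftrightarrow>
     (\<exists>U. open U \<and> cball 0 1 \<subseteq> U \<and> openin (mtop M) (i ` U) \<and>
        diffeomorphism (euclidean_piece U) (open_submanifold M (i ` U)) i \<and>
        orientation_preserving (euclidean_piece U) (open_submanifold M (i ` U)) i)"

definition orientation_reversing_disc ::
  "('a, 'n::finite) atlas_space \<Rightarrow> (real^'n \<Rightarrow> 'a) \<Rightarrow> bool" where
  "orientation_reversing_disc M i \<longleftrightarrow>
     (\<exists>U. open U \<and> cball 0 1 \<subseteq> U \<and> openin (mtop M) (i ` U) \<and>
        diffeomorphism (euclidean_piece U) (open_submanifold M (i ` U)) i \<and>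
        orientation_reversing (euclidean_piece U) (open_submanifold M (i ` U)) i)"

definition quotient_topology :: "'a topology \<Rightarrow> ('a \<Rightarrow> 'b) \<Rightarrow> 'b topology" where
  "quotient_topology X q =
     topology (\<lambda>W. W \<subseteq> q ` topspace X \<and> openin X {x \<in> topspace X. q x \<in> W})"

lemma openin_quotient_topology:
  "openin (quotient_topology X q) W \<longleftrightarrow>
     W \<subseteq> q ` topspace X \<and> openin X {x \<in> topspace X. q x \<in> W}"
proof -
  let ?P = "\<lambda>W. W \<subseteq> q ` topspace X \<and> openin X {x \<in> topspace X. q x \<in> W}"
  have "?P (S \<inter> T)" if "?P S" "?P T" for S T
  proof -
    have "{x \<in> topspace X. q x \<in> S \<inter> T} =
            {x \<in> topspace X. q x \<in> S} \<inter> {x \<in> topspace X. q x \<in> T}"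
      by blast
    with that show ?thesis
      by (simp only: openin_Int) (simp add: le_infI1)
  qed
  moreover have "?P (\<Union>\<K>)" if "\<forall>K\<in>\<K>. ?P K" for \<K>
  proof -
    have "{x \<in> topspace X. q x \<in> \<Union>\<K>} = \<Union> ((\<lambda>K. {x \<in> topspace X. q x \<in> K}) ` \<K>)"
      by blast
    moreover have "openin X (\<Union> ((\<lambda>K. {x \<in> topspace X. q x \<in> K}) ` \<K>))"
      using that by (intro openin_Union) blast
    moreover have "\<Union>\<K> \<subseteq> q ` topspace X"
      using that by (intro Union_least) blast
    ultimately show ?thesis
      by simp
  qed
  ultimately have "istopology ?P"
    unfolding istopology_def by (intro conjI allI impI) simp_all
  then show ?thesis
    by (simp add: quotient_topology_def)
qed

lemma topspace_quotient_topology [simp]: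
  "topspace (quotient_topology X q) = q ` topspace X"
proof
  show "topspace (quotient_topology X q) \<subseteq> q ` topspace X"
    using openin_topspace[of "quotient_topology X q"]
    by (simp only: openin_quotient_topology)
  have "{x \<in> topspace X. q x \<in> q ` topspace X} = topspace X"
    by auto
  then show "q ` topspace X \<subseteq> topspace (quotient_topology X q)"
    by (intro openin_subset) (simp add: openin_quotient_topology)
qed

lemma quotient_map_quotient_topology: "quotient_map X (quotient_topology X q) q"
  by (simp add: quotient_map_def openin_quotient_topology)

text \<open>Transport of a chart along a map that is injective on its domain.\<close>

definition push_chart :: "('a \<Rightarrow> 'b) \<Rightarrow> ('a, 'n::finite) chart \<Rightarrow> ('b, 'n) chart" where
  "push_chart h = (\<lambda>(U, \<phi>). (h ` U, \<phi> \<circ> inv_into U h))"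

definition puncture :: "('a, 'n::finite) atlas_space \<Rightarrow> 'a \<Rightarrow> ('a, 'n) atlas_space" where
  "puncture M p = open_submanifold M (topspace (mtop M) - {p})"

text \<open>The connected sum along two discs \<open>i : D\<^sup>n \<rightarrow> M\<close> and \<open>j : D\<^sup>n \<rightarrow> M'\<close>, following
  Kervaire and Milnor: in the disjoint union of \<open>M - i(0)\<close> (tag \<open>False\<close>) and \<open>M' - j(0)\<close>
  (tag \<open>True\<close>), the point \<open>i(tu)\<close> is identified with \<open>j((1-t)u)\<close> for each unit vector \<open>u\<close>
  and \<open>0 < t < 1\<close>. If \<open>i\<close> preserves and \<open>j\<close> reverses orientation, the identification is
  compatible with the orientations of both \<open>M\<close> and \<open>M'\<close>.\<close>

definition punctured_union ::
  "('a, 'n::finite) atlas_space \<Rightarrow> ('a, 'n) atlas_space \<Rightarrow> (real^'n \<Rightarrow> 'a) \<Rightarrow> (real^'n \<Rightarrow> 'a)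
     \<Rightarrow> (bool \<times> 'a) topology" where
  "punctured_union M M' i j =
     sum_topology (\<lambda>b. if b then mtop (puncture M' (j 0)) else mtop (puncture M (i 0))) UNIV"

definition attached ::
  "(real^'n::finite \<Rightarrow> 'a) \<Rightarrow> (real^'n \<Rightarrow> 'a) \<Rightarrow> bool \<times> 'a \<Rightarrow> bool \<times> 'a \<Rightarrow> bool" where
  "attached i j x y \<longleftrightarrow>
     (\<exists>u t. norm u = 1 \<and> 0 < t \<and> t < 1 \<and>
        x = (False, i (t *\<^sub>R u)) \<and> y = (True, j ((1 - t) *\<^sub>R u)))"

definition gluing_class ::
  "(real^'n::finite \<Rightarrow> 'a) \<Rightarrow> (real^'n \<Rightarrow> 'a) \<Rightarrow> bool \<times> 'a \<Rightarrow> (bool \<times> 'a) set" where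
  "gluing_class i j x = {y. y = x \<or> attached i j x y \<or> attached i j y x}"

definition connected_sum_along ::
  "('a, 'n::finite) atlas_space \<Rightarrow> ('a, 'n) atlas_space \<Rightarrow> (real^'n \<Rightarrow> 'a) \<Rightarrow> (real^'n \<Rightarrow> 'a)
     \<Rightarrow> ((bool \<times> 'a) set, 'n) atlas_space" where
  "connected_sum_along M M' i j =
     \<lparr>mtop = quotient_topology (punctured_union M M' i j) (gluing_class i j),
      atlas = push_chart (\<lambda>x. gluing_class i j (False, x)) ` atlas (puncture M (i 0)) \<union>
              push_chart (\<lambda>x. gluing_class i j (True, x)) ` atlas (puncture M' (j 0))\<rparr>"

text \<open>The connected sum is only defined up to orientation preserving diffeomorphism;
  \<open>is_connected_sum M M' N\<close> says that \<open>N\<close> represents the diffeomorphism type of \<open>M # M'\<close>.\<close>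

definition is_connected_sum ::
  "('a, 'n::finite) atlas_space \<Rightarrow> ('a, 'n) atlas_space \<Rightarrow> ('b, 'n) atlas_space \<Rightarrow> bool" where
  "is_connected_sum M M' N \<longleftrightarrow>
     (\<exists>i j. orientation_preserving_disc M i \<and> orientation_reversing_disc M' j \<and>
        oriented_diffeomorphic (connected_sum_along M M' i j) N)"

end

theory Submission
  imports Defs
begin

text \<open>The proof is an infinite swindle. Every connected oriented manifold \<open>M\<close> of dimension at
  least 2 is absorbed by some connected oriented manifold \<open>N\<close>, in the sense that \<open>M # N\<close> is
  diffeomorphic to \<open>N\<close>. An additive invariant \<open>c\<close> then satisfies \<open>c(N) = c(M) + c(N)\<close>, so \<open>c(M) = 0\<close>.

  The manifold \<open>N = \<real>\<^sup>n # M # M # \<dots>\<close> arises from \<open>\<real>\<^sup>n\<close> by attaching a copy of \<open>M\<close> at each of the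
  points \<open>0, v, 2v, \<dots>\<close>, where \<open>v\<close> is a vector of length 4. A further copy of \<open>M\<close> can be attached
  at the point \<open>-v\<close>, and translation by \<open>v\<close> carries the result back to \<open>N\<close>. Since all copies are
  attached by the same formula, the translation respects the identifications literally, and no
  isotopy of discs has to be constructed (\<open>absorbs\<close>).

  Two facts about gluing carry the argument. Pieces glued along orientation preserving smooth
  transitions become open submanifolds of the glued space (\<open>signed_embedding_piece\<close>), which makes
  \<open>N\<close> a manifold. Conversely, a manifold covered by embedded pieces is the space glued from
  them (\<open>glue_embeddings\<close>); applied to copy number 0 of \<open>M\<close> and to the shifted \<open>N\<close>, which
  together cover \<open>N\<close>, it identifies \<open>N\<close> with \<open>M # N\<close>. Analytically, the central point is that
  the map \<open>t u \<mapsto> (1 - t) u\<close> by which connected sums are glued is smooth and reverses orientation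
  (\<open>signed_smooth_radial_flip\<close>). The dimension enters through the connectedness of \<open>\<real>\<^sup>n\<close> with
  countably many points removed.\<close>

section \<open>Calculus of maps of class \<open>C\<^sup>k\<close>\<close>

lemma Ck_on_transform:
  fixes f g :: "real^'n::finite \<Rightarrow> real^'m::finite"
  assumes "open S" "\<And>x. x \<in> S \<Longrightarrow> f x = g x" "Ck_on k S f"
  shows "Ck_on k S g"
  using assms(2,3)
proof (induction k arbitrary: f g)
  case 0
  then show ?case by (simp cong: continuous_on_cong)
next
  case (Suc k)
  have d: "f differentiable at x" if "x \<in> S" for x
    using Suc.prems that by simp
  have eq: "frechet_derivative f (at x) = frechet_derivative g (at x)" if "x \<in> S" for x
    using frechet_derivative_transform_within_open[OF d[OF that] assms(1) that] Suc.prems(1) by blast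
  have "g differentiable at x" if "x \<in> S" for x
    using d[OF that] Suc.prems(1) assms(1) that has_derivative_transform_within_open
    unfolding differentiable_def by blast
  moreover have "Ck_on k S (\<lambda>x. frechet_derivative g (at x) v)" for v
    by (rule Suc.IH[of "\<lambda>x. frechet_derivative f (at x) v"]) (use Suc.prems eq in auto)
  ultimately show ?case by simp
qed

lemma Ck_on_subset: "Ck_on k T f \<Longrightarrow> S \<subseteq> T \<Longrightarrow> Ck_on k S f"
  by (induction k arbitrary: f) (auto intro: continuous_on_subset)

text \<open>Derivatives are taken at a point and not within the set, so smoothness only depends on a
  neighbourhood of each point. This is what allows a map between manifolds to be examined in a
  single pair of charts near each point.\<close>

lemma Ck_on_local:
  fixes f :: "real^'n::finite \<Rightarrow> real^'m::finite"
  assumes "\<And>x. x \<in> S \<Longrightarrow> \<exists>T. open T \<and> x \<in> T \<and> Ck_on k T f"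
  shows "Ck_on k S f"
  using assms
proof (induction k arbitrary: f)
  case 0
  then have "isCont f x" if "x \<in> S" for x
    using that continuous_on_eq_continuous_at by (metis Ck_on.simps(1))
  then show ?case by (simp add: continuous_at_imp_continuous_on)
next
  case (Suc k)
  have "f differentiable at x" if "x \<in> S" for x using Suc.prems[OF that] by auto
  moreover have "Ck_on k S (\<lambda>x. frechet_derivative f (at x) v)" for v
    by (rule Suc.IH) (use Suc.prems in fastforce)
  ultimately show ?case by simp
qed

lemma Ck_on_SucI:
  fixes f :: "real^'n::finite \<Rightarrow> real^'m::finite"
  assumes "open S" "\<And>x. x \<in> S \<Longrightarrow> (f has_derivative f' x) (at x)"
    and "\<And>v. Ck_on k S (\<lambda>x. f' x v)"
  shows "Ck_on (Suc k) S f"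
proof -
  have "Ck_on k S (\<lambda>x. frechet_derivative f (at x) v)" for v
    by (rule Ck_on_transform[OF assms(1) _ assms(3)[of v]])
       (simp add: frechet_derivative_at[OF assms(2), symmetric])
  then show ?thesis using assms(2) by (auto simp: differentiable_def)
qed

lemma Ck_on_SucD:
  assumes "Ck_on (Suc k) S f" "x \<in> S"
  shows "(f has_derivative frechet_derivative f (at x)) (at x)"
  using assms by (simp add: frechet_derivative_works)

lemma Ck_on_Suc_imp:
  fixes f :: "real^'n::finite \<Rightarrow> real^'m::finite"
  shows "Ck_on (Suc k) S f \<Longrightarrow> Ck_on k S f"
proof (induction k arbitrary: f)
  case 0
  then have "isCont f x" if "x \<in> S" for x
    using that differentiable_imp_continuous_within by auto
  then show ?case by (simp add: continuous_at_imp_continuous_on)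
next
  case (Suc k)
  have "Ck_on k S (\<lambda>x. frechet_derivative f (at x) v)" for v
    by (rule Suc.IH) (use Suc.prems in simp)
  moreover have "f differentiable at x" if "x \<in> S" for x using Suc.prems that by simp
  ultimately show ?case by simp
qed

lemma Ck_on_const: "open S \<Longrightarrow> Ck_on k S (\<lambda>x. c :: real^'m::finite)" for S :: "(real^'n::finite) set"
  by (induction k arbitrary: c) (auto intro!: Ck_on_SucI[where f' = "\<lambda>_ _. 0"])

lemma Ck_on_linear:
  fixes f :: "real^'n::finite \<Rightarrow> real^'m::finite"
  assumes "open S" "linear f"
  shows "Ck_on k S f"
proof (cases k)
  case 0
  then show ?thesis using assms linear_continuous_on linear_conv_bounded_linear by auto
next
  case (Suc l)
  then show ?thesis using assms
    by (auto intro!: Ck_on_SucI[where f' = "\<lambda>_. f"] Ck_on_const bounded_linear_imp_has_derivative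
        simp: linear_conv_bounded_linear simp del: Ck_on.simps)
qed

lemma Ck_on_add:
  fixes f g :: "real^'n::finite \<Rightarrow> real^'m::finite"
  assumes "open S" "Ck_on k S f" "Ck_on k S g"
  shows "Ck_on k S (\<lambda>x. f x + g x)"
  using assms(2,3)
proof (induction k arbitrary: f g)
  case 0
  then show ?case by (auto intro: continuous_intros)
next
  case (Suc k)
  show ?case
  proof (rule Ck_on_SucI[OF assms(1)])
    show "((\<lambda>x. f x + g x) has_derivative
        (\<lambda>v. frechet_derivative f (at x) v + frechet_derivative g (at x) v)) (at x)" if "x \<in> S" for x
      using Suc.prems that by (auto intro!: has_derivative_add Ck_on_SucD)
    show "Ck_on k S (\<lambda>x. frechet_derivative f (at x) v + frechet_derivative g (at x) v)" for v
      by (rule Suc.IH) (use Suc.prems in auto)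
  qed
qed

lemma Ck_on_sum:
  fixes f :: "'i \<Rightarrow> real^'n::finite \<Rightarrow> real^'m::finite"
  assumes "open S" "\<And>i. i \<in> I \<Longrightarrow> Ck_on k S (f i)"
  shows "Ck_on k S (\<lambda>x. \<Sum>i\<in>I. f i x)"
  using assms(2)
  by (induction I rule: infinite_finite_induct) (auto intro: Ck_on_const Ck_on_add assms(1))

lemma Ck_on_scale:
  fixes f :: "real^'n::finite \<Rightarrow> real^'m::finite" and g :: "real^'n \<Rightarrow> real^'l::finite"
  assumes "open S" "Ck_on k S f" "Ck_on k S g"
  shows "Ck_on k S (\<lambda>x. (f x $ i) *\<^sub>R g x)"
  using assms(2,3)
proof (induction k arbitrary: f g)
  case 0
  then show ?case by (auto intro!: continuous_intros)
next
  case (Suc k)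
  show ?case
  proof (rule Ck_on_SucI[OF assms(1)])
    show "((\<lambda>x. (f x $ i) *\<^sub>R g x) has_derivative
        (\<lambda>v. (f x $ i) *\<^sub>R frechet_derivative g (at x) v
            + (frechet_derivative f (at x) v $ i) *\<^sub>R g x)) (at x)" if "x \<in> S" for x
      using Suc.prems that
      by (intro has_derivative_scaleR bounded_linear.has_derivative[OF bounded_linear_vec_nth] Ck_on_SucD)
    show "Ck_on k S (\<lambda>x. (f x $ i) *\<^sub>R frechet_derivative g (at x) v
            + (frechet_derivative f (at x) v $ i) *\<^sub>R g x)" for v
      using Suc.prems by (intro Ck_on_add Suc.IH assms(1) Ck_on_Suc_imp[of k S f] Ck_on_Suc_imp[of k S g]) auto
  qed
qed

text \<open>By the chain rule the directional derivative of \<open>g \<circ> f\<close> is \<open>Dg (f x)\<close> applied to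
  \<open>Df x v\<close>. Expanding the latter in coordinates turns it into a finite sum of products of a
  component of \<open>Df x v\<close> with \<open>Dg (f x) e\<^sub>i\<close>, and the induction hypothesis applies to the
  second factor.\<close>

lemma Ck_on_compose:
  fixes f :: "real^'n::finite \<Rightarrow> real^'m::finite" and g :: "real^'m \<Rightarrow> real^'l::finite"
  assumes "open S" "open T" "f ` S \<subseteq> T" "Ck_on k S f" "Ck_on k T g"
  shows "Ck_on k S (g \<circ> f)"
  using assms(4,5)
proof (induction k arbitrary: g)
  case 0
  then show ?case
    using continuous_on_compose[of S f g] continuous_on_subset[of T g "f ` S"] assms(3) by simp
next
  case (Suc k)
  let ?Df = "\<lambda>x. frechet_derivative f (at x)" and ?Dg = "\<lambda>x. frechet_derivative g (at x)"
  show ?case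
  proof (rule Ck_on_SucI[OF assms(1)])
    show "((g \<circ> f) has_derivative (?Dg (f x) \<circ> ?Df x)) (at x)" if "x \<in> S" for x
      using that assms(3)
      by (intro diff_chain_at Ck_on_SucD[OF Suc.prems(1)] Ck_on_SucD[OF Suc.prems(2)]) auto
    fix v
    have eq: "(\<Sum>i\<in>UNIV. (?Df x v $ i) *\<^sub>R ?Dg (f x) (axis i 1)) = (?Dg (f x) \<circ> ?Df x) v"
      if "x \<in> S" for x
    proof -
      have "linear (?Dg (f x))"
        using Suc.prems(2) that assms(3) by (auto intro!: linear_frechet_derivative)
      then have "?Dg (f x) (\<Sum>i\<in>UNIV. (?Df x v $ i) *\<^sub>R axis i 1)
          = (\<Sum>i\<in>UNIV. (?Df x v $ i) *\<^sub>R ?Dg (f x) (axis i 1))"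
        by (simp add: linear_sum linear_scale)
      then show ?thesis
        using basis_expansion[of "?Df x v"] by (simp add: scalar_mult_eq_scaleR)
    qed
    have "Ck_on k S (\<lambda>x. ?Dg (f x) w)" for w
      using Suc.IH[of "\<lambda>y. ?Dg y w"] Suc.prems Ck_on_Suc_imp[of k S f] by (simp add: o_def)
    then have "Ck_on k S (\<lambda>x. \<Sum>i\<in>UNIV. (?Df x v $ i) *\<^sub>R ?Dg (f x) (axis i 1))"
      using Suc.prems by (intro Ck_on_sum Ck_on_scale assms(1)) auto
    then show "Ck_on k S (\<lambda>x. (?Dg (f x) \<circ> ?Df x) v)"
      by (rule Ck_on_transform[OF assms(1), rotated]) (rule eq)
  qed
qed

section \<open>Smooth maps whose Jacobian has a given sign\<close>

text \<open>The sign \<open>s\<close> is \<open>1\<close> or \<open>-1\<close> in all applications. Treating it as a factor puts orientation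
  preserving and orientation reversing maps under one notion, with signs multiplying under
  composition.\<close>

definition signed_smooth :: "real \<Rightarrow> (real^'n::finite) set \<Rightarrow> (real^'n \<Rightarrow> real^'n) \<Rightarrow> bool" where
  "signed_smooth s S f \<longleftrightarrow> smooth_on S f \<and> (\<forall>x\<in>S. s * jacobian_det f x > 0)"

lemma signed_smooth_subset: "signed_smooth s T f \<Longrightarrow> S \<subseteq> T \<Longrightarrow> signed_smooth s S f"
  unfolding signed_smooth_def smooth_on_def using Ck_on_subset by blast

lemma smooth_on_differentiable: "smooth_on S f \<Longrightarrow> x \<in> S \<Longrightarrow> f differentiable at x"
  unfolding smooth_on_def using Ck_on.simps(2) by blast

lemma signed_smooth_local:
  fixes f :: "real^'n::finite \<Rightarrow> real^'n"
  assumes "\<And>x. x \<in> S \<Longrightarrow> \<exists>T g. open T \<and> x \<in> T \<and> signed_smooth s T g \<and> (\<forall>y\<in>T. g y = f y)"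
  shows "signed_smooth s S f"
proof -
  have "\<exists>T. open T \<and> x \<in> T \<and> (\<forall>k. Ck_on k T f) \<and> s * jacobian_det f x > 0" if x: "x \<in> S" for x
  proof -
    obtain T g where T: "open T" "x \<in> T" "signed_smooth s T g" "\<And>y. y \<in> T \<Longrightarrow> g y = f y"
      using assms[OF x] by blast
    have "frechet_derivative g (at x) = frechet_derivative f (at x)"
      using frechet_derivative_transform_within_open[of g x T f] T
      by (metis signed_smooth_def smooth_on_differentiable)
    then show ?thesis
      using T Ck_on_transform[of T g f] unfolding signed_smooth_def smooth_on_def jacobian_det_def
      by metis
  qed
  then show ?thesis
    unfolding signed_smooth_def smooth_on_def using Ck_on_local[of S _ f] by metis
qed

lemma signed_smooth_transform:
  fixes f :: "real^'n::finite \<Rightarrow> real^'n"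
  assumes "open S" "\<And>x. x \<in> S \<Longrightarrow> g x = f x" "signed_smooth s S g"
  shows "signed_smooth s S f"
  by (rule signed_smooth_local) (use assms in blast)

lemma signed_smooth_compose:
  fixes f :: "real^'n::finite \<Rightarrow> real^'n" and g :: "real^'n \<Rightarrow> real^'n"
  assumes "open S" "open T" "f ` S \<subseteq> T" "signed_smooth s S f" "signed_smooth t T g"
  shows "signed_smooth (s * t) S (g \<circ> f)"
proof -
  have "smooth_on S (g \<circ> f)"
    using assms Ck_on_compose unfolding signed_smooth_def smooth_on_def by blast
  moreover have "s * t * jacobian_det (g \<circ> f) x > 0" if x: "x \<in> S" for x
  proof -
    have fx: "f x \<in> T" using assms(3) x by blast
    have d: "(f has_derivative frechet_derivative f (at x)) (at x)"
      "(g has_derivative frechet_derivative g (at (f x))) (at (f x))"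
      using assms(4,5) x fx smooth_on_differentiable unfolding signed_smooth_def
      by (metis frechet_derivative_works)+
    have "frechet_derivative (g \<circ> f) (at x)
        = frechet_derivative g (at (f x)) \<circ> frechet_derivative f (at x)"
      using frechet_derivative_at[OF diff_chain_at[OF d]] by simp
    then have "jacobian_det (g \<circ> f) x = jacobian_det g (f x) * jacobian_det f x"
      unfolding jacobian_det_def using d
      by (simp add: matrix_compose has_derivative_linear det_mul)
    moreover have "(s * jacobian_det f x) * (t * jacobian_det g (f x)) > 0"
      using assms(4,5) x fx unfolding signed_smooth_def by (intro mult_pos_pos[of "s * _"]) auto
    ultimately show ?thesis by (simp add: mult_ac)
  qed
  ultimately show ?thesis by (simp add: signed_smooth_def)
qed

section \<open>Smooth maps between open subsets of manifolds\<close>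

text \<open>The part of being a manifold that makes sense of smooth maps and their composition. A glued
  space has it from the outset, whereas its compatibility and separation properties have to be
  derived from those of the pieces.\<close>

definition charted :: "('a, 'n::finite) atlas_space \<Rightarrow> bool" where
  "charted M \<longleftrightarrow> (\<forall>\<kappa>\<in>atlas M. is_chart (mtop M) \<kappa>) \<and>
     (\<Union>\<kappa>\<in>atlas M. fst \<kappa>) = topspace (mtop M)"

lemma chartedE:
  assumes "charted M" "x \<in> topspace (mtop M)"
  obtains U \<phi> where "(U, \<phi>) \<in> atlas M" "x \<in> U"
proof -
  obtain \<kappa> where "\<kappa> \<in> atlas M" "x \<in> fst \<kappa>"
    using assms unfolding charted_def by (metis UN_E)
  then show thesis using that[of "fst \<kappa>" "snd \<kappa>"] by simp
qed

lemma chart_props: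
  assumes "charted M" "(U, \<phi>) \<in> atlas M"
  shows chart_openin: "openin (mtop M) U"
    and chart_inj: "inj_on \<phi> U"
    and chart_open_image: "openin (mtop M) W \<Longrightarrow> W \<subseteq> U \<Longrightarrow> open (\<phi> ` W)"
    and chart_homeomorphic: "homeomorphic_map (subtopology (mtop M) U) (top_of_set (\<phi> ` U)) \<phi>"
proof -
  have c: "openin (mtop M) U" "open (\<phi> ` U)"
    "homeomorphic_map (subtopology (mtop M) U) (top_of_set (\<phi> ` U)) \<phi>"
    using assms unfolding charted_def is_chart_def by auto
  then show "openin (mtop M) U"
    "homeomorphic_map (subtopology (mtop M) U) (top_of_set (\<phi> ` U)) \<phi>" by auto
  have t: "topspace (subtopology (mtop M) U) = U"
    using openin_subset[OF c(1)] by auto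
  show "inj_on \<phi> U"
    using c(3) t by (metis homeomorphic_imp_injective_map)
  show "open (\<phi> ` W)" if "openin (mtop M) W" "W \<subseteq> U"
  proof -
    have "openin (subtopology (mtop M) U) W"
      using that c(1) by (simp add: openin_open_subtopology)
    then have "openin (top_of_set (\<phi> ` U)) (\<phi> ` W)"
      using homeomorphic_imp_open_map[OF c(3)] by (simp add: open_map_def)
    then show ?thesis using c(2) openin_open_trans by blast
  qed
qed

text \<open>Maps out of a glued space are assembled from their restrictions to open sets, so the open
  domain \<open>W\<close> belongs to the notion. Continuity is stated by preimages that are open in \<open>M\<close>
  itself, which keeps subspace topologies out of the proofs.\<close>

definition signed_smooth_on ::
  "real \<Rightarrow> ('a, 'n::finite) atlas_space \<Rightarrow> ('b, 'n) atlas_space \<Rightarrow> 'a set \<Rightarrow> ('a \<Rightarrow> 'b) \<Rightarrow> bool" where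
  "signed_smooth_on s M N W f \<longleftrightarrow> openin (mtop M) W \<and> f ` W \<subseteq> topspace (mtop N) \<and>
     (\<forall>Q. openin (mtop N) Q \<longrightarrow> openin (mtop M) (W \<inter> f -` Q)) \<and>
     (\<forall>U \<phi> V \<psi>. (U, \<phi>) \<in> atlas M \<longrightarrow> (V, \<psi>) \<in> atlas N \<longrightarrow>
        signed_smooth s (\<phi> ` (U \<inter> W \<inter> f -` V)) (\<psi> \<circ> f \<circ> inv_into U \<phi>))"

lemma signed_smooth_onI:
  assumes "openin (mtop M) W" "\<And>x. x \<in> W \<Longrightarrow> f x \<in> topspace (mtop N)"
    and "\<And>Q. openin (mtop N) Q \<Longrightarrow> openin (mtop M) (W \<inter> f -` Q)"
    and "\<And>U \<phi> V \<psi>. (U, \<phi>) \<in> atlas M \<Longrightarrow> (V, \<psi>) \<in> atlas N \<Longrightarrow>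
        signed_smooth s (\<phi> ` (U \<inter> W \<inter> f -` V)) (\<psi> \<circ> f \<circ> inv_into U \<phi>)"
  shows "signed_smooth_on s M N W f"
  using assms unfolding signed_smooth_on_def by auto

lemma signed_smooth_onD:
  assumes "signed_smooth_on s M N W f"
  shows "openin (mtop M) W" "x \<in> W \<Longrightarrow> f x \<in> topspace (mtop N)"
    "openin (mtop N) Q \<Longrightarrow> openin (mtop M) (W \<inter> f -` Q)"
    "(U, \<phi>) \<in> atlas M \<Longrightarrow> (V, \<psi>) \<in> atlas N \<Longrightarrow>
        signed_smooth s (\<phi> ` (U \<inter> W \<inter> f -` V)) (\<psi> \<circ> f \<circ> inv_into U \<phi>)"
  using assms unfolding signed_smooth_on_def by auto

lemma signed_smooth_on_subset:
  assumes "signed_smooth_on s M N W f" "openin (mtop M) W'" "W' \<subseteq> W"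
  shows "signed_smooth_on s M N W' f"
proof (rule signed_smooth_onI)
  show "openin (mtop M) (W' \<inter> f -` Q)" if "openin (mtop N) Q" for Q
  proof -
    have "W' \<inter> f -` Q = W' \<inter> (W \<inter> f -` Q)" using assms(3) by auto
    then show ?thesis using signed_smooth_onD(3)[OF assms(1) that] assms(2) openin_Int by metis
  qed
  show "signed_smooth s (\<phi> ` (U \<inter> W' \<inter> f -` V)) (\<psi> \<circ> f \<circ> inv_into U \<phi>)"
    if "(U, \<phi>) \<in> atlas M" "(V, \<psi>) \<in> atlas N" for U \<phi> V \<psi>
    by (rule signed_smooth_subset[OF signed_smooth_onD(4)[OF assms(1) that]]) (use assms(3) in auto)
qed (use assms signed_smooth_onD(2)[OF assms(1)] in auto)

lemma signed_smooth_on_local: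
  assumes M: "charted M" and N: "charted N"
    and loc: "\<And>x. x \<in> W \<Longrightarrow> \<exists>W' g. x \<in> W' \<and> W' \<subseteq> W \<and> signed_smooth_on s M N W' g \<and>
      (\<forall>y\<in>W'. g y = f y)"
  shows "signed_smooth_on s M N W f"
proof (rule signed_smooth_onI)
  show "openin (mtop M) W"
    by (subst openin_subopen) (meson loc signed_smooth_onD(1))
  show "f x \<in> topspace (mtop N)" if "x \<in> W" for x
    using loc[OF that] signed_smooth_onD(2) by metis
  show "openin (mtop M) (W \<inter> f -` Q)" if Q: "openin (mtop N) Q" for Q
  proof (subst openin_subopen, intro ballI)
    fix x assume x: "x \<in> W \<inter> f -` Q"
    then obtain W' g where g: "x \<in> W'" "W' \<subseteq> W" "signed_smooth_on s M N W' g" "\<forall>y\<in>W'. g y = f y"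
      using loc by blast
    show "\<exists>T. openin (mtop M) T \<and> x \<in> T \<and> T \<subseteq> W \<inter> f -` Q"
      using signed_smooth_onD(3)[OF g(3) Q] g x by (intro exI[of _ "W' \<inter> g -` Q"]) auto
  qed
  fix U \<phi> V \<psi> assume U: "(U, \<phi>) \<in> atlas M" and V: "(V, \<psi>) \<in> atlas N"
  show "signed_smooth s (\<phi> ` (U \<inter> W \<inter> f -` V)) (\<psi> \<circ> f \<circ> inv_into U \<phi>)"
  proof (rule signed_smooth_local)
    fix y assume "y \<in> \<phi> ` (U \<inter> W \<inter> f -` V)"
    then obtain x where x: "y = \<phi> x" "x \<in> U" "x \<in> W" "f x \<in> V" by auto
    then obtain W' g where g: "x \<in> W'" "W' \<subseteq> W" "signed_smooth_on s M N W' g" "\<forall>y\<in>W'. g y = f y"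
      using loc by blast
    let ?D = "\<phi> ` (U \<inter> W' \<inter> g -` V)"
    have "openin (mtop M) (U \<inter> (W' \<inter> g -` V))"
      using signed_smooth_onD(3)[OF g(3)] chart_openin[OF N V] chart_openin[OF M U] by auto
    then have "open ?D"
      using chart_open_image[OF M U] by (metis Int_assoc Int_lower1)
    moreover have "y \<in> ?D" using x g by auto
    moreover have "signed_smooth s ?D (\<psi> \<circ> g \<circ> inv_into U \<phi>)"
      by (rule signed_smooth_onD(4)[OF g(3) U V])
    moreover have "\<forall>z\<in>?D. (\<psi> \<circ> g \<circ> inv_into U \<phi>) z = (\<psi> \<circ> f \<circ> inv_into U \<phi>) z"
      using g(4) chart_inj[OF M U] by auto
    ultimately show "\<exists>T h. open T \<and> y \<in> T \<and> signed_smooth s T h \<and>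
        (\<forall>z\<in>T. h z = (\<psi> \<circ> f \<circ> inv_into U \<phi>) z)" by blast
  qed
qed

lemma signed_smooth_on_transform:
  assumes "charted M" "charted N" "signed_smooth_on s M N W g" "\<And>x. x \<in> W \<Longrightarrow> g x = f x"
  shows "signed_smooth_on s M N W f"
  by (rule signed_smooth_on_local[OF assms(1,2)]) (use assms(3,4) in blast)

text \<open>Near a given point the coordinate expression of \<open>g \<circ> f\<close> factors through one chart of the
  middle space \<open>N\<close>, where the Euclidean chain rule applies; locality does the rest.\<close>

lemma signed_smooth_on_compose:
  assumes M: "charted M" and N: "charted N" and P: "charted P"
    and f: "signed_smooth_on s M N W f" and g: "signed_smooth_on t N P W' g" and sub: "f ` W \<subseteq> W'"
  shows "signed_smooth_on (s * t) M P W (g \<circ> f)"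
proof (rule signed_smooth_onI)
  have pre: "openin (mtop M) (W \<inter> (g \<circ> f) -` Q)" if Q: "openin (mtop P) Q" for Q
  proof -
    have "W \<inter> (g \<circ> f) -` Q = W \<inter> f -` (W' \<inter> g -` Q)" using sub by auto
    then show ?thesis using signed_smooth_onD(3)[OF f signed_smooth_onD(3)[OF g Q]] by simp
  qed
  then show "openin (mtop M) (W \<inter> (g \<circ> f) -` Q)" if Q: "openin (mtop P) Q" for Q using that .
  show "openin (mtop M) W" by (rule signed_smooth_onD(1)[OF f])
  show "(g \<circ> f) x \<in> topspace (mtop P)" if "x \<in> W" for x
    using signed_smooth_onD(2)[OF g] sub that by auto
  fix U \<phi> V \<psi> assume U: "(U, \<phi>) \<in> atlas M" and V: "(V, \<psi>) \<in> atlas P"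
  show "signed_smooth (s * t) (\<phi> ` (U \<inter> W \<inter> (g \<circ> f) -` V)) (\<psi> \<circ> (g \<circ> f) \<circ> inv_into U \<phi>)"
  proof (rule signed_smooth_local)
    fix y assume "y \<in> \<phi> ` (U \<inter> W \<inter> (g \<circ> f) -` V)"
    then obtain x where x: "y = \<phi> x" "x \<in> U" "x \<in> W" "g (f x) \<in> V" by auto
    obtain U' \<phi>' where U': "(U', \<phi>') \<in> atlas N" "f x \<in> U'"
      using chartedE[OF N signed_smooth_onD(2)[OF f x(3)]] by blast
    let ?E = "U' \<inter> W' \<inter> g -` V"
    let ?D = "U \<inter> W \<inter> f -` ?E"
    have E: "openin (mtop N) ?E"
      using signed_smooth_onD(3)[OF g] chart_openin[OF P V] chart_openin[OF N U'(1)]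
      by (simp add: Int_assoc openin_Int)
    have D: "openin (mtop M) ?D"
      using signed_smooth_onD(3)[OF f E] chart_openin[OF M U] by (simp add: Int_assoc openin_Int)
    have oD: "open (\<phi> ` ?D)" and oE: "open (\<phi>' ` ?E)"
      using chart_open_image[OF M U D] chart_open_image[OF N U'(1) E] by auto
    have inj: "inj_on \<phi> U" "inj_on \<phi>' U'"
      using chart_inj[OF M U] chart_inj[OF N U'(1)] by auto
    have 1: "signed_smooth s (\<phi> ` ?D) (\<phi>' \<circ> f \<circ> inv_into U \<phi>)"
      by (rule signed_smooth_subset[OF signed_smooth_onD(4)[OF f U U'(1)]]) auto
    have 2: "signed_smooth t (\<phi>' ` ?E) (\<psi> \<circ> g \<circ> inv_into U' \<phi>')"
      by (rule signed_smooth_onD(4)[OF g U'(1) V])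
    have "signed_smooth (s * t) (\<phi> ` ?D) ((\<psi> \<circ> g \<circ> inv_into U' \<phi>') \<circ> (\<phi>' \<circ> f \<circ> inv_into U \<phi>))"
      by (rule signed_smooth_compose[OF oD oE _ 1 2]) (use inj in auto)
    moreover have "\<forall>z\<in>\<phi> ` ?D. ((\<psi> \<circ> g \<circ> inv_into U' \<phi>') \<circ> (\<phi>' \<circ> f \<circ> inv_into U \<phi>)) z
        = (\<psi> \<circ> (g \<circ> f) \<circ> inv_into U \<phi>) z"
      using inj by auto
    moreover have "y \<in> \<phi> ` ?D" using x U' sub by auto
    ultimately show "\<exists>T h. open T \<and> y \<in> T \<and> signed_smooth (s * t) T h \<and>
        (\<forall>z\<in>T. h z = (\<psi> \<circ> (g \<circ> f) \<circ> inv_into U \<phi>) z)" using oD by blast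
  qed
qed

text \<open>Transition maps are the coordinate expressions of the identity.\<close>

lemma oriented_smooth_manifold_iff:
  "oriented_smooth_manifold M \<longleftrightarrow> Hausdorff_space (mtop M) \<and> second_countable (mtop M) \<and>
     charted M \<and> signed_smooth_on 1 M M (topspace (mtop M)) id"
proof -
  have 1: "U \<inter> topspace (mtop M) \<inter> id -` V = U \<inter> id -` V"
    if "charted M" "(U, \<phi>) \<in> atlas M" for U V \<phi>
    using openin_subset[OF chart_openin[OF that]] by auto
  have 2: "signed_smooth_on 1 M M (topspace (mtop M)) id \<longleftrightarrow> (\<forall>\<kappa>\<in>atlas M. \<forall>\<mu>\<in>atlas M.
        smooth_on (loc_dom id \<kappa> \<mu>) (loc_rep id \<kappa> \<mu>) \<and>
        (\<forall>x\<in>loc_dom id \<kappa> \<mu>. jacobian_det (loc_rep id \<kappa> \<mu>) x > 0))" if "charted M"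
  proof -
    have "(\<forall>\<kappa>\<in>atlas M. \<forall>\<mu>\<in>atlas M. P \<kappa> \<mu>) \<longleftrightarrow> (\<forall>U \<phi> V \<psi>. (U, \<phi>) \<in> atlas M \<longrightarrow> (V, \<psi>) \<in> atlas M \<longrightarrow>
        P (U, \<phi>) (V, \<psi>))" for P
      by auto
    then show ?thesis
      unfolding signed_smooth_on_def using 1[OF that]
      by (simp add: loc_dom_def loc_rep_def signed_smooth_def openin_Int vimage_def)
  qed
  show ?thesis
    unfolding oriented_smooth_manifold_def using 2 unfolding charted_def by meson
qed

lemma signed_smooth_on_smooth_map:
  assumes M: "charted M" and f: "signed_smooth_on s M N (topspace (mtop M)) f"
  shows "smooth_map M N f"
    and "\<kappa> \<in> atlas M \<Longrightarrow> \<mu> \<in> atlas N \<Longrightarrow> x \<in> loc_dom f \<kappa> \<mu> \<Longrightarrow> s * jacobian_det (loc_rep f \<kappa> \<mu>) x > 0"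
proof -
  have 1: "U \<inter> topspace (mtop M) \<inter> f -` V = U \<inter> f -` V"
    if "(U, \<phi>) \<in> atlas M" for U V \<phi>
    using openin_subset[OF chart_openin[OF M that]] by auto
  have 2: "signed_smooth s (loc_dom f \<kappa> \<mu>) (loc_rep f \<kappa> \<mu>)" if "\<kappa> \<in> atlas M" "\<mu> \<in> atlas N" for \<kappa> \<mu>
    using that signed_smooth_onD(4)[OF f, of "fst \<kappa>" "snd \<kappa>" "fst \<mu>" "snd \<mu>"] 1[of "fst \<kappa>" "snd \<kappa>"]
    by (simp add: loc_dom_def loc_rep_def split_beta)
  have "continuous_map (mtop M) (mtop N) f"
    unfolding continuous_map_def using signed_smooth_onD(2,3)[OF f]
    by (auto simp: Int_def vimage_def)
  then show "smooth_map M N f"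
    unfolding smooth_map_def using 2 by (auto simp: signed_smooth_def)
  show "s * jacobian_det (loc_rep f \<kappa> \<mu>) x > 0"
    if "\<kappa> \<in> atlas M" "\<mu> \<in> atlas N" "x \<in> loc_dom f \<kappa> \<mu>"
    using 2[OF that(1,2)] that(3) by (simp add: signed_smooth_def)
qed

lemma diffeomorphismI:
  assumes M: "charted M" and N: "charted N"
    and f: "signed_smooth_on s M N (topspace (mtop M)) f"
    and g: "signed_smooth_on t N M (topspace (mtop N)) g"
    and "\<And>x. x \<in> topspace (mtop M) \<Longrightarrow> g (f x) = x" "\<And>y. y \<in> topspace (mtop N) \<Longrightarrow> f (g y) = y"
  shows "diffeomorphism M N f"
    and "s = 1 \<Longrightarrow> orientation_preserving M N f"
    and "s = -1 \<Longrightarrow> orientation_reversing M N f"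
proof -
  note sm = signed_smooth_on_smooth_map[OF M f]
  show "diffeomorphism M N f"
    unfolding diffeomorphism_def homeomorphic_maps_def
    using sm(1) signed_smooth_on_smooth_map(1)[OF N g] assms(5,6) unfolding smooth_map_def by blast
  show "orientation_preserving M N f" if "s = 1"
    unfolding orientation_preserving_def using sm(2) that by simp
  show "orientation_reversing M N f" if "s = -1"
    unfolding orientation_reversing_def using sm(2) that by simp
qed

section \<open>Open submanifolds\<close>

lemma topspace_open_submanifold [simp]:
  "topspace (mtop (open_submanifold M W)) = topspace (mtop M) \<inter> W"
  by (simp add: open_submanifold_def)

lemma openin_open_submanifold:
  assumes "openin (mtop M) W"
  shows "openin (mtop (open_submanifold M W)) A \<longleftrightarrow> openin (mtop M) A \<and> A \<subseteq> W"
  by (simp add: open_submanifold_def openin_open_subtopology[OF assms])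

lemma charted_open_submanifold:
  assumes M: "charted M" and W: "openin (mtop M) W"
  shows "charted (open_submanifold M W)"
  unfolding charted_def
proof (intro conjI ballI)
  fix \<kappa> assume "\<kappa> \<in> atlas (open_submanifold M W)"
  then obtain U \<phi> where U: "(U, \<phi>) \<in> atlas M" "\<kappa> = (U \<inter> W, \<phi>)"
    by (auto simp: open_submanifold_def)
  have oUW: "openin (mtop M) (U \<inter> W)" using chart_openin[OF M U(1)] W by auto
  have "homeomorphic_map (subtopology (subtopology (mtop M) U) (U \<inter> W))
      (subtopology (top_of_set (\<phi> ` U)) (\<phi> ` (U \<inter> W))) \<phi>"
    by (rule homeomorphic_map_subtopologies[OF chart_homeomorphic[OF M U(1)]])
       (use openin_subset[OF oUW] openin_subset[OF chart_openin[OF M U(1)]] chart_inj[OF M U(1)]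
        in \<open>auto simp: inj_on_def\<close>)
  moreover have "U \<inter> (U \<inter> W) = W \<inter> (U \<inter> W)" "\<phi> ` U \<inter> \<phi> ` (U \<inter> W) = \<phi> ` (U \<inter> W)" by auto
  ultimately have "homeomorphic_map (subtopology (subtopology (mtop M) W) (U \<inter> W))
      (top_of_set (\<phi> ` (U \<inter> W))) \<phi>"
    by (simp add: subtopology_subtopology)
  then show "is_chart (mtop (open_submanifold M W)) \<kappa>"
    using oUW chart_open_image[OF M U(1) oUW] U(2)
    by (simp add: is_chart_def openin_open_submanifold[OF W]) (simp add: open_submanifold_def)
next
  have "(\<Union>\<kappa>\<in>atlas (open_submanifold M W). fst \<kappa>) = (\<Union>\<kappa>\<in>atlas M. fst \<kappa>) \<inter> W"
    by (auto simp: open_submanifold_def split_beta)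
  then show "(\<Union>\<kappa>\<in>atlas (open_submanifold M W). fst \<kappa>) = topspace (mtop (open_submanifold M W))"
    using M by (simp add: charted_def)
qed

lemma signed_smooth_on_from_open_submanifold:
  assumes M: "charted M" and N: "charted N" and W: "openin (mtop M) W"
    and f: "signed_smooth_on s M N A f" and A: "A \<subseteq> W"
  shows "signed_smooth_on s (open_submanifold M W) N A f"
proof (rule signed_smooth_onI)
  fix U' \<phi> V \<psi> assume "(U', \<phi>) \<in> atlas (open_submanifold M W)" and V: "(V, \<psi>) \<in> atlas N"
  then obtain U where U: "(U, \<phi>) \<in> atlas M" "U' = U \<inter> W" by (auto simp: open_submanifold_def)
  have "U \<inter> A \<inter> f -` V = U \<inter> W \<inter> A \<inter> f -` V" using A by auto
  then have s: "signed_smooth s (\<phi> ` (U \<inter> W \<inter> A \<inter> f -` V)) (\<psi> \<circ> f \<circ> inv_into U \<phi>)"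
    using signed_smooth_onD(4)[OF f U(1) V] by simp
  have "openin (mtop M) (U \<inter> W \<inter> (A \<inter> f -` V))"
    by (intro openin_Int[OF openin_Int[OF chart_openin[OF M U(1)] W]]
        signed_smooth_onD(3)[OF f chart_openin[OF N V]])
  then have o: "open (\<phi> ` (U \<inter> W \<inter> A \<inter> f -` V))"
    using chart_open_image[OF M U(1), of "U \<inter> W \<inter> A \<inter> f -` V"] by (auto simp: Int_assoc)
  have "inj_on \<phi> U" by (rule chart_inj[OF M U(1)])
  moreover from this have "inj_on \<phi> (U \<inter> W)" by (rule inj_on_subset) auto
  ultimately show "signed_smooth s (\<phi> ` (U' \<inter> A \<inter> f -` V)) (\<psi> \<circ> f \<circ> inv_into U' \<phi>)"
    unfolding U(2) by (intro signed_smooth_transform[OF o _ s]) auto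
qed (use signed_smooth_onD(1,2,3)[OF f] A in \<open>auto simp: openin_open_submanifold[OF W]\<close>)

lemma signed_smooth_on_into_open_submanifold:
  assumes W: "openin (mtop N) W"
    and f: "signed_smooth_on s M N A f" and A: "f ` A \<subseteq> W"
  shows "signed_smooth_on s M (open_submanifold N W) A f"
proof (rule signed_smooth_onI)
  fix U \<phi> V' \<psi> assume U: "(U, \<phi>) \<in> atlas M" and "(V', \<psi>) \<in> atlas (open_submanifold N W)"
  then obtain V where V: "(V, \<psi>) \<in> atlas N" "V' = V \<inter> W" by (auto simp: open_submanifold_def)
  show "signed_smooth s (\<phi> ` (U \<inter> A \<inter> f -` V')) (\<psi> \<circ> f \<circ> inv_into U \<phi>)"
    by (rule signed_smooth_subset[OF signed_smooth_onD(4)[OF f U V(1)]]) (use V(2) in auto)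
qed (use signed_smooth_onD(1,2,3)[OF f] A in \<open>auto simp: openin_open_submanifold[OF W]\<close>)

lemma signed_smooth_on_id_open_submanifold:
  assumes M: "charted M" and W: "openin (mtop M) W"
    and id: "signed_smooth_on 1 M M (topspace (mtop M)) id"
  shows "signed_smooth_on 1 (open_submanifold M W) (open_submanifold M W) W id"
proof -
  have "signed_smooth_on 1 M M W id"
    by (rule signed_smooth_on_subset[OF id W]) (rule openin_subset[OF W])
  then have "signed_smooth_on 1 M (open_submanifold M W) W id"
    by (rule signed_smooth_on_into_open_submanifold[OF W]) simp
  then show ?thesis
    by (rule signed_smooth_on_from_open_submanifold[OF M charted_open_submanifold[OF M W] W]) simp
qed

section \<open>Euclidean pieces and charts\<close>

lemma topspace_euclidean_piece [simp]: "topspace (mtop (euclidean_piece S)) = S"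
  by (simp add: euclidean_piece_def)

lemma openin_euclidean_piece:
  "open S \<Longrightarrow> openin (mtop (euclidean_piece S)) A \<longleftrightarrow> open A \<and> A \<subseteq> S"
  by (simp add: euclidean_piece_def openin_open_eq)

lemma charted_euclidean_piece:
  assumes "open S"
  shows "charted (euclidean_piece S)"
  using assms homeomorphic_map_id[of "top_of_set S" "top_of_set S"]
  by (simp add: charted_def euclidean_piece_def is_chart_def id_def subtopology_subtopology)

lemma signed_smooth_on_euclidean:
  assumes "open S" "open T" "open A" "A \<subseteq> S" "f ` A \<subseteq> T" "signed_smooth s A f"
  shows "signed_smooth_on s (euclidean_piece S) (euclidean_piece T) A f"
proof (rule signed_smooth_onI)
  have c: "continuous_on A f"
    using assms(6) by (metis signed_smooth_def smooth_on_def Ck_on.simps(1))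
  have o: "open (A \<inter> f -` Q)" if "open Q" for Q
    using c assms(3) that by (metis continuous_on_open_vimage Int_commute)
  show "openin (mtop (euclidean_piece S)) (A \<inter> f -` Q)" if "openin (mtop (euclidean_piece T)) Q" for Q
    using that o assms by (auto simp: openin_euclidean_piece)
  fix U \<phi> V \<psi> assume "(U, \<phi>) \<in> atlas (euclidean_piece S)" "(V, \<psi>) \<in> atlas (euclidean_piece T)"
  then have UV: "U = S" "\<phi> = id" "V = T" "\<psi> = id" by (auto simp: euclidean_piece_def)
  have "signed_smooth s (S \<inter> A \<inter> f -` T) f"
    by (rule signed_smooth_subset[OF assms(6)]) auto
  moreover have "open (S \<inter> A \<inter> f -` T)" using o[OF assms(2)] assms(1) by (simp add: Int_assoc open_Int)
  moreover have "inv_into S id x = x" if "x \<in> S" for x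
    using that inv_into_f_f[of id S x] by simp
  ultimately show "signed_smooth s (\<phi> ` (U \<inter> A \<inter> f -` V)) (\<psi> \<circ> f \<circ> inv_into U \<phi>)"
    unfolding UV by (auto intro: signed_smooth_transform[where g = f])
qed (use assms in \<open>auto simp: openin_euclidean_piece\<close>)

text \<open>In the charts of the atlas, a chart and its inverse are expressed by transition maps.\<close>

lemma chart_signed_smooth_on:
  assumes M: "charted M" and id: "signed_smooth_on 1 M M (topspace (mtop M)) id"
    and V: "(V, \<psi>) \<in> atlas M"
  shows "signed_smooth_on 1 M (euclidean_piece (\<psi> ` V)) V \<psi>"
    and "signed_smooth_on 1 (euclidean_piece (\<psi> ` V)) M (\<psi> ` V) (inv_into V \<psi>)"
proof -
  have oV: "openin (mtop M) V" and Vtop: "V \<subseteq> topspace (mtop M)"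
    using chart_openin[OF M V] openin_subset by auto
  have o: "open (\<psi> ` V)" using chart_open_image[OF M V oV] by simp
  have inj: "inj_on \<psi> V" by (rule chart_inj[OF M V])
  show "signed_smooth_on 1 M (euclidean_piece (\<psi> ` V)) V \<psi>"
  proof (rule signed_smooth_onI)
    fix Q assume "openin (mtop (euclidean_piece (\<psi> ` V))) Q"
    then have "openin (top_of_set (\<psi> ` V)) Q" by (simp add: euclidean_piece_def)
    then have "openin (subtopology (mtop M) V) {x \<in> topspace (subtopology (mtop M) V). \<psi> x \<in> Q}"
      using homeomorphic_imp_continuous_map[OF chart_homeomorphic[OF M V]]
      by (simp add: continuous_map_def)
    moreover have "{x \<in> topspace (subtopology (mtop M) V). \<psi> x \<in> Q} = V \<inter> \<psi> -` Q"
      using Vtop by auto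
    ultimately show "openin (mtop M) (V \<inter> \<psi> -` Q)" using oV by (simp add: openin_open_subtopology)
  next
    fix U \<phi> V' \<psi>' assume U: "(U, \<phi>) \<in> atlas M" and "(V', \<psi>') \<in> atlas (euclidean_piece (\<psi> ` V))"
    then have "V' = \<psi> ` V" "\<psi>' = id" by (auto simp: euclidean_piece_def)
    then show "signed_smooth 1 (\<phi> ` (U \<inter> V \<inter> \<psi> -` V')) (\<psi>' \<circ> \<psi> \<circ> inv_into U \<phi>)"
      using signed_smooth_subset[OF signed_smooth_onD(4)[OF id U V], of "\<phi> ` (U \<inter> V \<inter> \<psi> -` V')"] Vtop
      by fastforce
  qed (use oV in auto)
  show "signed_smooth_on 1 (euclidean_piece (\<psi> ` V)) M (\<psi> ` V) (inv_into V \<psi>)"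
  proof (rule signed_smooth_onI)
    show "openin (mtop (euclidean_piece (\<psi> ` V))) (\<psi> ` V)" using o by (simp add: openin_euclidean_piece)
    show "inv_into V \<psi> x \<in> topspace (mtop M)" if "x \<in> \<psi> ` V" for x
      using that inv_into_into[of x \<psi> V] Vtop by auto
    have im: "\<psi> ` V \<inter> inv_into V \<psi> -` Q = \<psi> ` (V \<inter> Q)" for Q
      using inj by auto
    show "openin (mtop (euclidean_piece (\<psi> ` V))) (\<psi> ` V \<inter> inv_into V \<psi> -` Q)"
      if "openin (mtop M) Q" for Q
      using chart_open_image[OF M V openin_Int[OF oV that]] o unfolding im
      by (auto simp: openin_euclidean_piece)
    fix V' \<psi>' U \<phi> assume "(V', \<psi>') \<in> atlas (euclidean_piece (\<psi> ` V))" and U: "(U, \<phi>) \<in> atlas M"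
    then have V': "V' = \<psi> ` V" "\<psi>' = id" by (auto simp: euclidean_piece_def)
    have s: "signed_smooth 1 (\<psi> ` (V \<inter> U)) (\<phi> \<circ> id \<circ> inv_into V \<psi>)"
      by (rule signed_smooth_subset[OF signed_smooth_onD(4)[OF id V U]]) (use Vtop in auto)
    have o': "open (\<psi> ` (V \<inter> U))"
      using chart_open_image[OF M V openin_Int[OF oV chart_openin[OF M U]]] by simp
    have "signed_smooth 1 (\<psi> ` (V \<inter> U)) (\<phi> \<circ> inv_into V \<psi> \<circ> inv_into (\<psi> ` V) id)"
    proof (rule signed_smooth_transform[OF o' _ s])
      fix x assume "x \<in> \<psi> ` (V \<inter> U)"
      then have "inv_into (\<psi> ` V) id x = x" using inv_into_f_f[of id "\<psi> ` V" x] by auto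
      then show "(\<phi> \<circ> id \<circ> inv_into V \<psi>) x = (\<phi> \<circ> inv_into V \<psi> \<circ> inv_into (\<psi> ` V) id) x" by simp
    qed
    then show "signed_smooth 1 (\<psi>' ` (V' \<inter> \<psi> ` V \<inter> inv_into V \<psi> -` U)) (\<phi> \<circ> inv_into V \<psi> \<circ> inv_into V' \<psi>')"
      unfolding V' using im[of U] by simp
  qed
qed

section \<open>Gluing manifolds\<close>

text \<open>Smoothness of the inverse is required explicitly: the inverses of all maps below are known,
  and so the inverse function theorem is avoided.\<close>

definition signed_embedding ::
  "real \<Rightarrow> ('a, 'n::finite) atlas_space \<Rightarrow> ('b, 'n) atlas_space \<Rightarrow> ('a \<Rightarrow> 'b) \<Rightarrow> bool" where
  "signed_embedding s M N f \<longleftrightarrow> inj_on f (topspace (mtop M)) \<and>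
     signed_smooth_on s M N (topspace (mtop M)) f \<and>
     signed_smooth_on s N M (f ` topspace (mtop M)) (inv_into (topspace (mtop M)) f)"

text \<open>The quotient of the disjoint union of the pieces \<open>A k\<close> that identifies points with the same
  image under the maps \<open>F k\<close>. Three instances occur: two pieces give a connected sum,
  countably many pieces give the infinite sum, and a single piece transports a manifold along an
  injection to another type of points.\<close>

definition glue ::
  "('k \<Rightarrow> ('a, 'n::finite) atlas_space) \<Rightarrow> ('k \<Rightarrow> 'a \<Rightarrow> 'b) \<Rightarrow> ('b, 'n) atlas_space" where
  "glue A F = \<lparr>mtop = quotient_topology (sum_topology (\<lambda>k. mtop (A k)) UNIV) (\<lambda>(k, x). F k x),
     atlas = (\<Union>k. push_chart (F k) ` atlas (A k))\<rparr>"

lemma connected_sum_along_eq_glue: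
  "connected_sum_along M M' i j =
     glue (\<lambda>b. if b then puncture M' (j 0) else puncture M (i 0)) (\<lambda>b x. gluing_class i j (b, x))"
  unfolding connected_sum_along_def glue_def punctured_union_def
  by (auto simp: UNIV_bool if_distrib[of mtop] split_def)

lemma topspace_glue: "topspace (mtop (glue A F)) = (\<Union>k. F k ` topspace (mtop (A k)))"
  by (force simp: glue_def)

lemma openin_glue:
  "openin (mtop (glue A F)) W \<longleftrightarrow> W \<subseteq> (\<Union>k. F k ` topspace (mtop (A k))) \<and>
     (\<forall>k. openin (mtop (A k)) (topspace (mtop (A k)) \<inter> F k -` W))"
proof -
  have "(\<lambda>(k, x). F k x) ` Sigma UNIV (topspace \<circ> (\<lambda>k. mtop (A k))) = (\<Union>k. F k ` topspace (mtop (A k)))"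
    by force
  moreover have "{x. x \<in> topspace (mtop (A k)) \<and> F k x \<in> W} = topspace (mtop (A k)) \<inter> F k -` W" for k
    by auto
  ultimately show ?thesis
    by (simp add: glue_def openin_quotient_topology openin_sum_topology subset_iff)
qed

text \<open>The maps \<open>F l\<^sup>-\<^sup>1 \<circ> F k\<close> between the pieces are smooth and orientation preserving on open
  domains, which makes each \<open>F k\<close> an oriented open embedding into the glued space.\<close>

locale gluing_data =
  fixes A :: "'k \<Rightarrow> ('a, 'n::finite) atlas_space" and F :: "'k \<Rightarrow> 'a \<Rightarrow> 'b"
  assumes charted_piece: "charted (A k)"
    and inj_piece: "inj_on (F k) (topspace (mtop (A k)))"
    and transition: "signed_smooth_on 1 (A k) (A l)
      (topspace (mtop (A k)) \<inter> F k -` F l ` topspace (mtop (A l)))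
      (inv_into (topspace (mtop (A l))) (F l) \<circ> F k)"
begin

text \<open>In another piece, the points identified with points of \<open>W\<close> form the preimage of \<open>W\<close> under a
  continuous transition between pieces.\<close>

lemma glue_open_map:
  assumes W: "openin (mtop (A k)) W"
  shows "openin (mtop (glue A F)) (F k ` W)"
  unfolding openin_glue
proof (intro conjI allI)
  have sub: "W \<subseteq> topspace (mtop (A k))" by (rule openin_subset[OF W])
  then show "F k ` W \<subseteq> (\<Union>k. F k ` topspace (mtop (A k)))" by auto
  fix l
  have "topspace (mtop (A l)) \<inter> F l -` F k ` W =
    (topspace (mtop (A l)) \<inter> F l -` F k ` topspace (mtop (A k)))
      \<inter> (inv_into (topspace (mtop (A k))) (F k) \<circ> F l) -` W"
    using sub inj_piece[of k] by (auto simp: inj_on_def)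
  then show "openin (mtop (A l)) (topspace (mtop (A l)) \<inter> F l -` F k ` W)"
    using signed_smooth_onD(3)[OF transition W] by metis
qed

lemma glue_continuous:
  "openin (mtop (glue A F)) Q \<Longrightarrow> openin (mtop (A k)) (topspace (mtop (A k)) \<inter> F k -` Q)"
  by (simp add: openin_glue)

lemma glue_homeomorphic:
  assumes U: "openin (mtop (A k)) U"
  shows "homeomorphic_map (subtopology (mtop (A k)) U) (subtopology (mtop (glue A F)) (F k ` U)) (F k)"
proof -
  have t: "topspace (subtopology (mtop (A k)) U) = U" using openin_subset[OF U] by auto
  have "continuous_map (mtop (A k)) (mtop (glue A F)) (F k)"
    unfolding continuous_map_def using glue_continuous
    by (auto simp: topspace_glue Int_def vimage_def)
  then have "continuous_map (subtopology (mtop (A k)) U) (mtop (glue A F)) (F k)"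
    by (rule continuous_map_from_subtopology)
  moreover have "open_map (subtopology (mtop (A k)) U) (mtop (glue A F)) (F k)"
    using glue_open_map by (simp add: open_map_def openin_open_subtopology[OF U])
  moreover have "inj_on (F k) (topspace (subtopology (mtop (A k)) U))"
    by (rule inj_on_subset[OF inj_piece]) auto
  ultimately have "embedding_map (subtopology (mtop (A k)) U) (mtop (glue A F)) (F k)"
    by (rule injective_open_imp_embedding_map)
  then show ?thesis unfolding embedding_map_def t .
qed

lemma charted_glue: "charted (glue A F)"
  unfolding charted_def
proof (intro conjI ballI)
  fix \<kappa> assume "\<kappa> \<in> atlas (glue A F)"
  then obtain k U \<phi> where U: "(U, \<phi>) \<in> atlas (A k)" "\<kappa> = (F k ` U, \<phi> \<circ> inv_into U (F k))"
    by (auto simp: glue_def push_chart_def)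
  have oU: "openin (mtop (A k)) U" by (rule chart_openin[OF charted_piece U(1)])
  have inj: "inj_on (F k) U" using inj_on_subset[OF inj_piece openin_subset[OF oU]] .
  have im: "(\<phi> \<circ> inv_into U (F k)) ` F k ` U = \<phi> ` U" using inj by force
  obtain g where g: "homeomorphic_maps (subtopology (mtop (A k)) U)
      (subtopology (mtop (glue A F)) (F k ` U)) (F k) g"
    using glue_homeomorphic[OF oU] homeomorphic_map_maps by blast
  have t: "topspace (subtopology (mtop (glue A F)) (F k ` U)) = F k ` U"
    using openin_subset[OF glue_open_map[OF oU]] by auto
  have "homeomorphic_map (subtopology (mtop (glue A F)) (F k ` U)) (subtopology (mtop (A k)) U) g"
    using g homeomorphic_maps_map by blast
  moreover have "g y = inv_into U (F k) y" if "y \<in> F k ` U" for y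
  proof -
    have "g y \<in> U" "F k (g y) = y"
      using g that t unfolding homeomorphic_maps_def continuous_map_def by auto
    then show ?thesis using inj by (metis inv_into_f_f)
  qed
  ultimately have "homeomorphic_map (subtopology (mtop (glue A F)) (F k ` U))
      (subtopology (mtop (A k)) U) (inv_into U (F k))"
    by (rule homeomorphic_map_eq) (simp only: t)
  then have "homeomorphic_map (subtopology (mtop (glue A F)) (F k ` U)) (top_of_set (\<phi> ` U))
      (\<phi> \<circ> inv_into U (F k))"
    by (rule homeomorphic_map_compose[OF _ chart_homeomorphic[OF charted_piece U(1)]])
  then show "is_chart (mtop (glue A F)) \<kappa>"
    using glue_open_map[OF oU] chart_open_image[OF charted_piece U(1) oU] U(2) im
    by (simp add: is_chart_def)
next
  have "(\<Union>\<kappa>\<in>atlas (glue A F). fst \<kappa>) = (\<Union>k. F k ` (\<Union>\<kappa>\<in>atlas (A k). fst \<kappa>))"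
    by (auto simp: glue_def push_chart_def split_def)
  then show "(\<Union>\<kappa>\<in>atlas (glue A F). fst \<kappa>) = topspace (mtop (glue A F))"
    using charted_piece by (simp add: charted_def topspace_glue)
qed

text \<open>In a chart pushed forward from the piece \<open>A l\<close>, the map \<open>F k\<close> has the same coordinate
  expression as the transition from \<open>A k\<close> to \<open>A l\<close>.\<close>

lemma signed_embedding_piece: "signed_embedding 1 (A k) (glue A F) (F k)"
  unfolding signed_embedding_def
proof (intro conjI)
  let ?X = "\<lambda>k. topspace (mtop (A k))"
  have chart_sub: "U \<subseteq> ?X l" "inj_on (F l) U" "inj_on \<phi> U" if "(U, \<phi>) \<in> atlas (A l)" for U \<phi> l
    using openin_subset[OF chart_openin[OF charted_piece that]]
      chart_inj[OF charted_piece that] inj_on_subset[OF inj_piece] by auto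
  have inv: "inv_into (?X l) (F l) (F l x) = x" if "x \<in> ?X l" for x l
    using inv_into_f_f[OF inj_piece that] .
  have otr: "open (\<phi> ` (U \<inter> (?X k \<inter> F k -` F l ` ?X l) \<inter> (inv_into (?X l) (F l) \<circ> F k) -` V))"
    if "(U, \<phi>) \<in> atlas (A k)" "(V, \<psi>) \<in> atlas (A l)" for U \<phi> V \<psi> k l
    by (intro chart_open_image[OF charted_piece that(1)])
      (use openin_Int[OF chart_openin[OF charted_piece that(1)]
        signed_smooth_onD(3)[OF transition[of k l] chart_openin[OF charted_piece that(2)]]]
       in \<open>auto simp: Int_assoc\<close>)
  show "inj_on (F k) (?X k)" by (rule inj_piece)
  show "signed_smooth_on 1 (A k) (glue A F) (?X k) (F k)"
  proof (rule signed_smooth_onI)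
    fix U \<phi> V' \<psi>'
    assume U: "(U, \<phi>) \<in> atlas (A k)" and "(V', \<psi>') \<in> atlas (glue A F)"
    then obtain l V \<psi> where V: "(V, \<psi>) \<in> atlas (A l)" "V' = F l ` V" "\<psi>' = \<psi> \<circ> inv_into V (F l)"
      by (auto simp: glue_def push_chart_def)
    let ?W = "?X k \<inter> F k -` F l ` ?X l" and ?T = "inv_into (?X l) (F l) \<circ> F k"
    have eq: "U \<inter> ?W \<inter> ?T -` V = U \<inter> ?X k \<inter> F k -` V'"
      using chart_sub(1)[OF V(1)] unfolding V(2) by (auto simp: inv)
    have "signed_smooth 1 (\<phi> ` (U \<inter> ?W \<inter> ?T -` V)) (\<psi>' \<circ> F k \<circ> inv_into U \<phi>)"
    proof (rule signed_smooth_transform[OF otr[OF U V(1)] _ signed_smooth_onD(4)[OF transition U V(1)]])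
      fix y assume "y \<in> \<phi> ` (U \<inter> ?W \<inter> ?T -` V)"
      then obtain x v where x: "y = \<phi> x" "x \<in> U" "v \<in> V" "F k x = F l v" unfolding eq V(2) by auto
      then show "(\<psi> \<circ> ?T \<circ> inv_into U \<phi>) y = (\<psi>' \<circ> F k \<circ> inv_into U \<phi>) y"
        using chart_sub[OF U] chart_sub[OF V(1)] V(3) by (auto simp: inv subsetD)
    qed
    then show "signed_smooth 1 (\<phi> ` (U \<inter> ?X k \<inter> F k -` V')) (\<psi>' \<circ> F k \<circ> inv_into U \<phi>)"
      unfolding eq .
  qed (auto simp: glue_continuous topspace_glue)
  show "signed_smooth_on 1 (glue A F) (A k) (F k ` ?X k) (inv_into (?X k) (F k))"
  proof (rule signed_smooth_onI)
    fix U' \<phi>' V \<psi>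
    assume "(U', \<phi>') \<in> atlas (glue A F)" and V: "(V, \<psi>) \<in> atlas (A k)"
    then obtain l U \<phi> where U: "(U, \<phi>) \<in> atlas (A l)" "U' = F l ` U" "\<phi>' = \<phi> \<circ> inv_into U (F l)"
      by (auto simp: glue_def push_chart_def)
    let ?W = "?X l \<inter> F l -` F k ` ?X k" and ?T = "inv_into (?X k) (F k) \<circ> F l"
    have eq: "\<phi>' ` (U' \<inter> F k ` ?X k \<inter> inv_into (?X k) (F k) -` V) = \<phi> ` (U \<inter> ?W \<inter> ?T -` V)"
    proof -
      have "U' \<inter> F k ` ?X k \<inter> inv_into (?X k) (F k) -` V = F l ` (U \<inter> ?W \<inter> ?T -` V)"
        using chart_sub(1)[OF U(1)] unfolding U(2) by auto
      moreover have "\<phi>' ` F l ` (U \<inter> ?W \<inter> ?T -` V) = \<phi> ` (U \<inter> ?W \<inter> ?T -` V)"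
        unfolding image_image U(3) using chart_sub(2)[OF U(1)] by (intro image_cong) auto
      ultimately show ?thesis by simp
    qed
    have inj': "inj_on \<phi>' U'"
      unfolding U(2,3) using chart_sub(2,3)[OF U(1)] by (auto simp: inj_on_def)
    have "signed_smooth 1 (\<phi> ` (U \<inter> ?W \<inter> ?T -` V)) (\<psi> \<circ> inv_into (?X k) (F k) \<circ> inv_into U' \<phi>')"
    proof (rule signed_smooth_transform[OF otr[OF U(1) V] _ signed_smooth_onD(4)[OF transition U(1) V]])
      fix y assume "y \<in> \<phi> ` (U \<inter> ?W \<inter> ?T -` V)"
      then obtain x where x: "y = \<phi> x" "x \<in> U" by auto
      then have "inv_into U' \<phi>' y = F l x"
        using inv_into_f_f[OF inj', of "F l x"] chart_sub(2)[OF U(1)] U(2,3) by simp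
      then show "(\<psi> \<circ> ?T \<circ> inv_into U \<phi>) y = (\<psi> \<circ> inv_into (?X k) (F k) \<circ> inv_into U' \<phi>') y"
        using x chart_sub[OF U(1)] by simp
    qed
    then show "signed_smooth 1 (\<phi>' ` (U' \<inter> F k ` ?X k \<inter> inv_into (?X k) (F k) -` V))
        (\<psi> \<circ> inv_into (?X k) (F k) \<circ> inv_into U' \<phi>')"
      unfolding eq .
  next
    fix Q assume Q: "openin (mtop (A k)) Q"
    have "F k ` ?X k \<inter> inv_into (?X k) (F k) -` Q = F k ` Q"
      using openin_subset[OF Q] by (auto simp: inv subsetD)
    then show "openin (mtop (glue A F)) (F k ` ?X k \<inter> inv_into (?X k) (F k) -` Q)"
      using glue_open_map[OF Q] by simp
  qed (auto simp: glue_open_map inv)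
qed

lemma signed_smooth_on_id_glue:
  "signed_smooth_on 1 (glue A F) (glue A F) (topspace (mtop (glue A F))) id"
proof (rule signed_smooth_on_local[OF charted_glue charted_glue])
  let ?X = "\<lambda>k. topspace (mtop (A k))"
  fix x assume "x \<in> topspace (mtop (glue A F))"
  then obtain k where k: "x \<in> F k ` ?X k" by (auto simp: topspace_glue)
  have "signed_smooth_on 1 (glue A F) (glue A F) (F k ` ?X k) (F k \<circ> inv_into (?X k) (F k))"
    using signed_smooth_on_compose[OF charted_glue charted_piece charted_glue, of 1 k "F k ` ?X k"
        "inv_into (?X k) (F k)" 1 "?X k" "F k"] signed_embedding_piece[of k]
      inv_into_into[of _ "F k" "?X k"] unfolding signed_embedding_def by auto
  then show "\<exists>W' g. x \<in> W' \<and> W' \<subseteq> topspace (mtop (glue A F)) \<and>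
      signed_smooth_on 1 (glue A F) (glue A F) W' g \<and> (\<forall>y\<in>W'. g y = id y)"
    using k by (intro exI[of _ "F k ` ?X k"] exI[of _ "F k \<circ> inv_into (?X k) (F k)"])
      (auto simp: topspace_glue f_inv_into_f)
qed

end

text \<open>A manifold \<open>P\<close> covered by embedded pieces is diffeomorphic to every space glued from these
  pieces with the same identifications. The transitions between pieces are \<open>E l\<^sup>-\<^sup>1 \<circ> E k\<close>, hence
  smooth, and \<open>\<Psi>\<close> is on each piece the composite \<open>F k \<circ> E k\<^sup>-\<^sup>1\<close>. This is how a given manifold is
  recognised as a connected sum.\<close>

lemma glue_embeddings:
  assumes A: "\<And>k. charted (A k)" and P: "charted P"
    and E: "\<And>k. signed_embedding 1 (A k) P (E k)"
    and cover: "(\<Union>k. E k ` topspace (mtop (A k))) = topspace (mtop P)"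
    and \<Psi>: "inj_on \<Psi> (topspace (mtop P))"
    and F: "\<And>k x. x \<in> topspace (mtop (A k)) \<Longrightarrow> F k x = \<Psi> (E k x)"
  shows "oriented_diffeomorphic (glue A F) P"
proof -
  let ?X = "\<lambda>k. topspace (mtop (A k))"
  let ?iE = "\<lambda>k. inv_into (?X k) (E k)" and ?iF = "\<lambda>k. inv_into (?X k) (F k)"
  have E': "inj_on (E k) (?X k)" "signed_smooth_on 1 (A k) P (?X k) (E k)"
    "signed_smooth_on 1 P (A k) (E k ` ?X k) (?iE k)" for k
    using E unfolding signed_embedding_def by auto
  have EP: "E k x \<in> topspace (mtop P)" if "x \<in> ?X k" for k x
    using cover that by auto
  have F_eq: "F k x = F l y \<longleftrightarrow> E k x = E l y" if "x \<in> ?X k" "y \<in> ?X l" for k l x y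
    using that F inj_onD[OF \<Psi>] EP by metis
  have injF: "inj_on (F k) (?X k)" for k
    by (rule inj_onI) (use F_eq E'(1)[of k] in \<open>auto dest: inj_onD\<close>)
  have invE: "?iE k (E k x) = x" and invF: "?iF k (F k x) = x" if "x \<in> ?X k" for k x
    using inv_into_f_f[OF E'(1) that] inv_into_f_f[OF injF that] by auto
  interpret gluing_data A F
  proof
    fix k l
    let ?W = "?X k \<inter> E k -` E l ` ?X l"
    have W: "?W = ?X k \<inter> F k -` F l ` ?X l"
      using F_eq by (auto simp: image_iff)
    have "openin (mtop (A k)) ?W"
      using signed_smooth_onD(3)[OF E'(2) signed_smooth_onD(1)[OF E'(3)]] .
    then have "signed_smooth_on 1 (A k) P ?W (E k)"
      by (rule signed_smooth_on_subset[OF E'(2)]) auto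
    then have "signed_smooth_on (1 * 1) (A k) (A l) ?W (?iE l \<circ> E k)"
      by (rule signed_smooth_on_compose[OF A P A _ E'(3)]) auto
    moreover have "(?iE l \<circ> E k) x = (?iF l \<circ> F k) x" if "x \<in> ?W" for x
    proof -
      obtain y where "y \<in> ?X l" "E k x = E l y" "F k x = F l y"
        using \<open>x \<in> ?W\<close> F_eq by auto
      then show ?thesis using invE invF by simp
    qed
    ultimately have "signed_smooth_on 1 (A k) (A l) ?W (?iF l \<circ> F k)"
      using signed_smooth_on_transform[OF A A] by fastforce
    then show "signed_smooth_on 1 (A k) (A l) (?X k \<inter> F k -` F l ` ?X l) (?iF l \<circ> F k)"
      unfolding W .
  qed (use A injF in auto)
  let ?G = "glue A F" and ?f = "inv_into (topspace (mtop P)) \<Psi>"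
  have F': "signed_smooth_on 1 (A k) ?G (?X k) (F k)"
    "signed_smooth_on 1 ?G (A k) (F k ` ?X k) (?iF k)" for k
    using signed_embedding_piece unfolding signed_embedding_def by auto
  have f: "?f (F k x) = E k x" if "x \<in> ?X k" for k x
    using F[OF that] inv_into_f_f[OF \<Psi> EP[OF that]] by simp
  have "signed_smooth_on 1 ?G P (topspace (mtop ?G)) ?f"
  proof (rule signed_smooth_on_local[OF charted_glue P])
    fix x assume "x \<in> topspace (mtop ?G)"
    then obtain k where k: "x \<in> F k ` ?X k" by (auto simp: topspace_glue)
    have "signed_smooth_on (1 * 1) ?G P (F k ` ?X k) (E k \<circ> ?iF k)"
      by (rule signed_smooth_on_compose[OF charted_glue A P F'(2) E'(2)]) (auto simp: invF)
    then show "\<exists>W' g. x \<in> W' \<and> W' \<subseteq> topspace (mtop ?G) \<and> signed_smooth_on 1 ?G P W' g \<and>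
        (\<forall>y\<in>W'. g y = ?f y)"
      using k by (intro exI[of _ "F k ` ?X k"] exI[of _ "E k \<circ> ?iF k"])
        (auto simp: topspace_glue invF f)
  qed
  moreover have "signed_smooth_on 1 P ?G (topspace (mtop P)) \<Psi>"
  proof (rule signed_smooth_on_local[OF P charted_glue])
    fix x assume "x \<in> topspace (mtop P)"
    then obtain k where k: "x \<in> E k ` ?X k" using cover by blast
    have "signed_smooth_on (1 * 1) P ?G (E k ` ?X k) (F k \<circ> ?iE k)"
      by (rule signed_smooth_on_compose[OF P A charted_glue E'(3) F'(1)]) (auto simp: invE)
    then show "\<exists>W' g. x \<in> W' \<and> W' \<subseteq> topspace (mtop P) \<and> signed_smooth_on 1 P ?G W' g \<and>
        (\<forall>y\<in>W'. g y = \<Psi> y)"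
      using k EP by (intro exI[of _ "E k ` ?X k"] exI[of _ "F k \<circ> ?iE k"])
        (auto simp: invE F)
  qed
  moreover have "\<Psi> (?f x) = x" if "x \<in> topspace (mtop ?G)" for x
    using that F f by (auto simp: topspace_glue)
  moreover have "?f (\<Psi> y) = y" if "y \<in> topspace (mtop P)" for y
    by (rule inv_into_f_f[OF \<Psi> that])
  ultimately show ?thesis
    unfolding oriented_diffeomorphic_def
    using diffeomorphismI[OF charted_glue P] by metis
qed

section \<open>Embeddings and discs\<close>

lemma signed_embeddingI:
  assumes M: "charted M" and N: "charted N"
    and f: "signed_smooth_on s M N (topspace (mtop M)) f"
    and g: "signed_smooth_on s N M (f ` topspace (mtop M)) g"
    and gf: "\<And>x. x \<in> topspace (mtop M) \<Longrightarrow> g (f x) = x"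
  shows "signed_embedding s M N f"
proof -
  have inj: "inj_on f (topspace (mtop M))" by (rule inj_on_inverseI[of _ g]) (rule gf)
  have "signed_smooth_on s N M (f ` topspace (mtop M)) (inv_into (topspace (mtop M)) f)"
    by (rule signed_smooth_on_transform[OF N M g]) (auto simp: gf inv_into_f_f[OF inj])
  then show ?thesis using inj f by (simp add: signed_embedding_def)
qed

lemma signed_embeddingD:
  assumes "signed_embedding s M N f"
  shows "inj_on f (topspace (mtop M))"
    "signed_smooth_on s M N (topspace (mtop M)) f"
    "signed_smooth_on s N M (f ` topspace (mtop M)) (inv_into (topspace (mtop M)) f)"
  using assms by (auto simp: signed_embedding_def)

lemma signed_embedding_inv:
  assumes "signed_embedding s M N f" "x \<in> topspace (mtop M)"
  shows "inv_into (topspace (mtop M)) f (f x) = x"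
  by (rule inv_into_f_f[OF signed_embeddingD(1)[OF assms(1)] assms(2)])

lemma signed_embedding_open:
  assumes f: "signed_embedding s M N f" and W: "openin (mtop M) W"
  shows "openin (mtop N) (f ` W)"
proof -
  have "f ` W = f ` topspace (mtop M) \<inter> inv_into (topspace (mtop M)) f -` W"
    using openin_subset[OF W] signed_embedding_inv[OF f] by (auto simp: subsetD)
  then show ?thesis using signed_smooth_onD(3)[OF signed_embeddingD(3)[OF f] W] by simp
qed

lemma signed_embedding_continuous:
  assumes f: "signed_embedding s M N f"
  shows "continuous_map (mtop M) (mtop N) f"
  unfolding continuous_map_def using signed_smooth_onD(2,3)[OF signed_embeddingD(2)[OF f]]
  by (auto simp: Int_def vimage_def)

lemma signed_embedding_inv_on:
  assumes f: "signed_embedding s M N f" and W: "openin (mtop M) W"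
  shows "signed_smooth_on s N M (f ` W) (inv_into (topspace (mtop M)) f)"
  by (rule signed_smooth_on_subset[OF signed_embeddingD(3)[OF f] signed_embedding_open[OF f W]])
     (use openin_subset[OF W] in auto)

lemma signed_embedding_compose:
  assumes M: "charted M" and N: "charted N" and P: "charted P"
    and f: "signed_embedding s M N f" and g: "signed_embedding t N P g"
  shows "signed_embedding (s * t) M P (g \<circ> f)"
proof (rule signed_embeddingI[OF M P])
  let ?X = "topspace (mtop M)" and ?Y = "topspace (mtop N)"
  have fX: "f x \<in> ?Y" if "x \<in> ?X" for x using signed_smooth_onD(2)[OF signed_embeddingD(2)[OF f] that] .
  show "signed_smooth_on (s * t) M P ?X (g \<circ> f)"
    by (rule signed_smooth_on_compose[OF M N P signed_embeddingD(2)[OF f] signed_embeddingD(2)[OF g]])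
       (use fX in auto)
  have "signed_smooth_on (t * s) P M (g ` f ` ?X) (inv_into ?X f \<circ> inv_into ?Y g)"
    by (rule signed_smooth_on_compose[OF P N M signed_embedding_inv_on[OF g signed_embedding_open[OF f]]
          signed_embeddingD(3)[OF f]]) (use fX signed_embedding_inv[OF g] in auto)
  then show "signed_smooth_on (s * t) P M ((g \<circ> f) ` ?X) (inv_into ?X f \<circ> inv_into ?Y g)"
    by (simp add: image_comp mult.commute)
  show "(inv_into ?X f \<circ> inv_into ?Y g) ((g \<circ> f) x) = x" if "x \<in> ?X" for x
    using fX[OF that] that signed_embedding_inv[OF f] signed_embedding_inv[OF g] by simp
qed

lemma signed_embedding_transform:
  assumes M: "charted M" and N: "charted N" and f: "signed_embedding s M N f"
    and eq: "\<And>x. x \<in> topspace (mtop M) \<Longrightarrow> f x = f' x"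
  shows "signed_embedding s M N f'"
proof (rule signed_embeddingI[OF M N])
  let ?X = "topspace (mtop M)"
  show "signed_smooth_on s M N ?X f'"
    by (rule signed_smooth_on_transform[OF M N signed_embeddingD(2)[OF f] eq])
  have "f ` ?X = f' ` ?X" using eq by auto
  then show "signed_smooth_on s N M (f' ` ?X) (inv_into ?X f)"
    using signed_embeddingD(3)[OF f] by simp
  show "inv_into ?X f (f' x) = x" if "x \<in> ?X" for x
    using signed_embedding_inv[OF f that] eq[OF that] by simp
qed

text \<open>The discs in the definition of a connected sum are embeddings of a neighbourhood of the closed
  unit ball, considered as diffeomorphisms onto their images.\<close>

lemma signed_embedding_disc:
  assumes M: "charted M" and U: "open U" "cball 0 1 \<subseteq> U"
    and i: "signed_embedding s (euclidean_piece U) M i"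
  shows "s = 1 \<Longrightarrow> orientation_preserving_disc M i"
    and "s = -1 \<Longrightarrow> orientation_reversing_disc M i"
proof -
  have E: "charted (euclidean_piece U)" by (rule charted_euclidean_piece[OF U(1)])
  have o: "openin (mtop M) (i ` U)"
    using signed_embedding_open[OF i, of U] U(1) by (simp add: openin_euclidean_piece)
  let ?N = "open_submanifold M (i ` U)"
  have 1: "signed_smooth_on s (euclidean_piece U) ?N (topspace (mtop (euclidean_piece U))) i"
    by (rule signed_smooth_on_into_open_submanifold[OF o signed_embeddingD(2)[OF i]]) simp
  have 2: "signed_smooth_on s ?N (euclidean_piece U) (topspace (mtop ?N)) (inv_into U i)"
    using signed_smooth_on_from_open_submanifold[OF M E o signed_embeddingD(3)[OF i]]
      openin_subset[OF o] by (simp add: Int_absorb1)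
  have inv: "inv_into U i (i x) = x" if "x \<in> U" for x
    using signed_embedding_inv[OF i] that by simp
  have d: "diffeomorphism (euclidean_piece U) ?N i"
    "s = 1 \<Longrightarrow> orientation_preserving (euclidean_piece U) ?N i"
    "s = -1 \<Longrightarrow> orientation_reversing (euclidean_piece U) ?N i"
    by (rule diffeomorphismI[OF E charted_open_submanifold[OF M o] 1 2]; use inv in auto)+
  show "s = 1 \<Longrightarrow> orientation_preserving_disc M i"
    unfolding orientation_preserving_disc_def using U o d by blast
  show "s = -1 \<Longrightarrow> orientation_reversing_disc M i"
    unfolding orientation_reversing_disc_def using U o d by blast
qed

section \<open>The gluing map of a connected sum\<close>

lemma signed_smooth_affine:
  fixes L :: "real^'n::finite \<Rightarrow> real^'n"
  assumes "open S" "linear L" "s * det (matrix L) > 0"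
  shows "signed_smooth s S (\<lambda>x. L x + c)"
proof -
  have d: "((\<lambda>x. L x + c) has_derivative L) (at x)" for x
    using assms(2) by (auto intro!: derivative_eq_intros bounded_linear_imp_has_derivative
        simp: linear_conv_bounded_linear)
  have "Ck_on k S (\<lambda>x. L x + c)" for k
    by (intro Ck_on_add Ck_on_linear Ck_on_const assms)
  then show ?thesis
    using assms(3) frechet_derivative_at[OF d]
    by (simp add: signed_smooth_def smooth_on_def jacobian_det_def flip: frechet_derivative_at[OF d])
qed

lemma signed_smooth_translation:
  "open S \<Longrightarrow> signed_smooth 1 S (\<lambda>x. x + c)" for S :: "(real^'n::finite) set"
  using signed_smooth_affine[of S id 1 c] by (simp add: linear_id matrix_id_mat_1)

text \<open>The directional derivative of \<open>(x \<bullet> x)\<^sup>s q(x)\<close> is a sum of two maps of the same form, with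
  exponents \<open>s - 1\<close> and \<open>s\<close> and other smooth factors. Hence the induction is over all \<open>s\<close> and
  \<open>q\<close> simultaneously.\<close>

lemma Ck_on_power_of_norm:
  fixes q :: "real^'n::finite \<Rightarrow> real^'n"
  assumes "\<And>k. Ck_on k (- {0}) q"
  shows "Ck_on k (- {0}) (\<lambda>x. ((x \<bullet> x) powr s) *\<^sub>R q x)"
  using assms
proof (induction k arbitrary: s q)
  case 0
  have "continuous_on (- {0}) q" using 0[of 0] by simp
  then show ?case by (auto intro!: continuous_intros)
next
  case (Suc k)
  let ?Dq = "\<lambda>x. frechet_derivative q (at x)"
  have o: "open (- {0 :: real^'n})" by (rule open_Compl[OF closed_singleton])
  show ?case
  proof (rule Ck_on_SucI[OF o])
    fix x :: "real^'n" assume x: "x \<in> - {0}"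
    have q: "(q has_derivative ?Dq x) (at x)" using Ck_on_SucD[OF Suc.prems x] .
    have "((\<lambda>x. x \<bullet> x) has_derivative (\<lambda>v. x \<bullet> v + v \<bullet> x)) (at x)"
      by (auto intro!: derivative_eq_intros)
    then have "((\<lambda>x. (x \<bullet> x) powr s) has_derivative (\<lambda>v. (s * (x \<bullet> x) powr (s - 1)) * (x \<bullet> v + v \<bullet> x))) (at x)"
      using has_derivative_compose[of "\<lambda>x. x \<bullet> x" _ x UNIV "\<lambda>r. r powr s"
          "\<lambda>r. (s * (x \<bullet> x) powr (s - 1)) * r"] has_real_derivative_powr[of "x \<bullet> x" s] x
      by (simp add: has_field_derivative_def)
    from has_derivative_scaleR[OF this q]
    show "((\<lambda>x. ((x \<bullet> x) powr s) *\<^sub>R q x) has_derivative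
        (\<lambda>v. ((x \<bullet> x) powr (s - 1)) *\<^sub>R (((2 * s * (x \<bullet> v))) *\<^sub>R q x) + ((x \<bullet> x) powr s) *\<^sub>R ?Dq x v)) (at x)"
      by (simp add: inner_commute algebra_simps)
  next
    fix v :: "real^'n"
    have "linear (\<lambda>x :: real^'n. \<chi> i::'n. 2 * s * (x \<bullet> v))"
      by (rule linearI) (auto simp: vec_eq_iff inner_add_left algebra_simps)
    then have "Ck_on k (- {0}) (\<lambda>x. ((\<chi> i::'n. 2 * s * (x \<bullet> v)) $ undefined) *\<^sub>R q x)" for k
      by (intro Ck_on_scale Ck_on_linear o Suc.prems)
    then have 1: "Ck_on k (- {0}) (\<lambda>x. (2 * s * (x \<bullet> v)) *\<^sub>R q x)" for k by simp
    have 2: "Ck_on k (- {0}) (\<lambda>x. ?Dq x v)" for k using Suc.prems[of "Suc k"] by simp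
    show "Ck_on k (- {0}) (\<lambda>x. ((x \<bullet> x) powr (s - 1)) *\<^sub>R (((2 * s * (x \<bullet> v))) *\<^sub>R q x) + ((x \<bullet> x) powr s) *\<^sub>R ?Dq x v)"
      by (intro Ck_on_add o Suc.IH 1 2)
  qed
qed

text \<open>The identification \<open>t u \<mapsto> (1 - t) u\<close> (with \<open>u\<close> a unit vector and \<open>0 < t < 1\<close>) by which
  connected sums are glued.\<close>

definition radial_flip :: "real^'n::finite \<Rightarrow> real^'n" where
  "radial_flip x = (1 / norm x - 1) *\<^sub>R x"

abbreviation punctured_ball :: "(real^'n::finite) set" where
  "punctured_ball \<equiv> ball 0 1 - {0}"

lemma norm_radial_flip: "x \<in> punctured_ball \<Longrightarrow> norm (radial_flip x) = 1 - norm x"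
  by (auto simp: radial_flip_def abs_if field_simps)

lemma radial_flip_in: "x \<in> punctured_ball \<Longrightarrow> radial_flip x \<in> punctured_ball"
  using norm_radial_flip[of x] by auto

lemma radial_flip_involution: 
  assumes "x \<in> punctured_ball" shows "radial_flip (radial_flip x) = x"
proof -
  have "radial_flip (radial_flip x) = ((1 / (1 - norm x) - 1) * (1 / norm x - 1)) *\<^sub>R x"
    by (subst radial_flip_def, subst norm_radial_flip[OF assms]) (simp add: radial_flip_def)
  also have "(1 / (1 - norm x) - 1) * (1 / norm x - 1) = 1"
    using assms by (simp add: field_simps)
  finally show ?thesis by simp
qed

lemma radial_flip_scale:
  assumes "norm u = 1" "0 < t" "t < 1"
  shows "radial_flip ((1 - t) *\<^sub>R u) = t *\<^sub>R u"
proof -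
  have "norm ((1 - t) *\<^sub>R u) = 1 - t" using assms by simp
  moreover have "(1 / (1 - t) - 1) * (1 - t) = t" using assms by (simp add: field_simps)
  ultimately show ?thesis by (simp add: radial_flip_def)
qed

text \<open>The derivative at \<open>x\<close> is \<open>-1\<close> on the line through \<open>x\<close> and the positive factor
  \<open>1 / norm x - 1\<close> on its orthogonal complement, so its determinant is negative. The
  determinant is computed after rotating \<open>x\<close> to a coordinate axis, where the matrix is
  diagonal.\<close>

lemma signed_smooth_radial_flip:
  "signed_smooth (-1) punctured_ball (radial_flip :: real^'n::finite \<Rightarrow> real^'n)"
proof -
  let ?g = "\<lambda>x :: real^'n. ((x \<bullet> x) powr (-1/2)) *\<^sub>R x + (- x)"
  \<comment> \<open>Smoothness away from the origin comes from \<open>1 / norm x = (x \<bullet> x)\<^sup>-\<^sup>1\<^sup>/\<^sup>2\<close>.\<close>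
  have eq: "?g x = radial_flip x" if "x \<noteq> 0" for x :: "real^'n"
  proof -
    have "(x \<bullet> x) powr (-1/2) = 1 / norm x"
      using that by (simp add: powr_minus powr_half_sqrt norm_eq_sqrt_inner divide_simps)
    then show ?thesis by (simp add: radial_flip_def algebra_simps)
  qed
  have o: "open (- {0 :: real^'n})" by (rule open_Compl[OF closed_singleton])
  have "Ck_on k (- {0}) ?g" for k
    by (intro Ck_on_add Ck_on_power_of_norm o Ck_on_linear linearI) auto
  then have C: "Ck_on k (- {0}) (radial_flip :: real^'n \<Rightarrow> real^'n)" for k
    using Ck_on_transform[OF o, of ?g radial_flip k] eq by auto
  then have "smooth_on punctured_ball (radial_flip :: real^'n \<Rightarrow> real^'n)"
    unfolding smooth_on_def using Ck_on_subset by blast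
  moreover have "jacobian_det radial_flip x < 0" if x: "x \<in> punctured_ball" for x :: "real^'n"
  proof -
    have x0: "x \<noteq> 0" "norm x < 1" using x by auto
    define r where "r = norm x"
    define a where "a = 1 / r - 1"
    have r: "0 < r" "r < 1" using x0 by (auto simp: r_def)
    have a: "a > 0" using r by (simp add: a_def)
    obtain k :: 'n where True by simp
    let ?D = "\<lambda>v :: real^'n. a *\<^sub>R v - ((x \<bullet> v) / r ^ 3) *\<^sub>R x"
    have norm': "(norm has_derivative (\<lambda>v. x \<bullet> v / r)) (at x)"
      using has_derivative_norm[OF x0(1)] by (simp add: sgn_div_norm r_def inner_commute divide_inverse mult.commute)
    have "((\<lambda>x. 1 / norm x - 1) has_derivative (\<lambda>v. - ((x \<bullet> v / r) / r\<^sup>2))) (at x)"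
      using has_derivative_diff[OF Deriv.has_derivative_inverse[OF _ norm'] has_derivative_const[of 1]] x0(1)
      by (simp add: r_def power2_eq_square divide_inverse mult_ac)
    from has_derivative_scaleR[OF this has_derivative_ident]
    have "(radial_flip has_derivative ?D) (at x)"
      by (simp add: radial_flip_def[abs_def] a_def r_def power2_eq_square power3_eq_cube mult.assoc)
    then have "?D = frechet_derivative radial_flip (at x)" by (rule frechet_derivative_at)
    then have D: "jacobian_det radial_flip x = det (matrix ?D)" by (simp only: jacobian_det_def)
    have "norm (r *\<^sub>R axis k 1 :: real^'n) = norm x"
      using r(1) by (simp only: norm_scaleR norm_axis_1) (simp add: r_def)
    then obtain Q :: "real^'n \<Rightarrow> real^'n"
      where Q: "orthogonal_transformation Q" "Q (r *\<^sub>R axis k 1) = x"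
      using orthogonal_transformation_exists by blast
    let ?L = "\<lambda>v :: real^'n. a *\<^sub>R v - ((1 / r) * v $ k) *\<^sub>R axis k 1"
    have lL: "linear ?L"
      by (rule linearI) (auto simp: algebra_simps)
    have lQ: "linear Q" using Q(1) orthogonal_transformation_linear by blast
    \<comment> \<open>\<open>?L\<close> is the derivative at the point \<open>r *\<^sub>R axis k 1\<close> of the axis.\<close>
    have comm: "?D \<circ> Q = Q \<circ> ?L"
    proof
      fix v
      have "x \<bullet> Q v = r * v $ k"
        using Q(1) unfolding orthogonal_transformation_def Q(2)[symmetric]
        by (simp add: inner_axis' inner_commute[of "axis k 1"] inner_axis)
      moreover have "Q (?L v) = a *\<^sub>R Q v - ((1 / r) * v $ k) *\<^sub>R Q (axis k 1)"
        using lQ by (simp add: linear_diff linear_scale)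
      moreover have "Q (axis k 1) = (1 / r) *\<^sub>R x"
        using linear_scale[OF lQ, of r "axis k 1"] r(1) unfolding Q(2) by simp
      ultimately show "(?D \<circ> Q) v = (Q \<circ> ?L) v"
        using r by (simp add: power3_eq_cube power2_eq_square)
    qed
    have lD: "linear ?D"
      by (rule linearI) (auto simp: inner_add_right algebra_simps add_divide_distrib)
    have "matrix ?D ** matrix Q = matrix Q ** matrix ?L"
      unfolding matrix_compose[OF lQ lD, symmetric] comm by (rule matrix_compose[OF lL lQ])
    then have "det (matrix ?D) * det (matrix Q) = det (matrix Q) * det (matrix ?L)"
      unfolding det_mul[symmetric] by (rule arg_cong)
    moreover have "det (matrix Q) \<noteq> 0"
      using Q(1) det_orthogonal_matrix[of "matrix Q"] unfolding orthogonal_transformation_matrix by auto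
    ultimately have "det (matrix ?D) = det (matrix ?L)" by (auto simp: mult.commute[of _ "det (matrix Q)"])
    also have "\<dots> = (\<Prod>i\<in>UNIV. matrix ?L $ i $ i)"
      by (rule det_diagonal) (auto simp: matrix_def axis_def)
    also have "\<dots> = (\<Prod>i\<in>UNIV. if i = k then -1 else a)"
      by (rule prod.cong) (auto simp: matrix_def axis_def a_def)
    also have "\<dots> = - (\<Prod>i\<in>UNIV - {k}. a)"
      by (subst prod.remove[of _ k]) (auto intro!: prod.cong)
    also have "\<dots> < 0" using a by (simp add: prod_pos)
    finally show ?thesis using D by simp
  qed
  ultimately show ?thesis by (simp add: signed_smooth_def)
qed

text \<open>The reflection in an arbitrary coordinate; it is needed because a connected sum uses an
  orientation reversing disc in the second summand.\<close>

definition reflect :: "real^'n::finite \<Rightarrow> real^'n" where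
  "reflect x = (\<chi> i. if i = (SOME i. True) then - x $ i else x $ i)"

lemma reflect_reflect [simp]: "reflect (reflect x) = x"
  by (simp add: reflect_def vec_eq_iff)

lemma norm_reflect [simp]: "norm (reflect x) = norm x"
proof -
  have "reflect x \<bullet> reflect x = x \<bullet> x"
    unfolding inner_vec_def by (rule sum.cong) (auto simp: reflect_def)
  then show ?thesis by (simp add: norm_eq_sqrt_inner)
qed

lemma linear_reflect: "linear reflect"
  by (rule linearI) (auto simp: reflect_def vec_eq_iff)

lemma reflect_zero [simp]: "reflect 0 = 0"
  using linear_0[OF linear_reflect] .

lemma det_reflect: "det (matrix (reflect :: real^'n::finite \<Rightarrow> real^'n)) = -1"
proof -
  have "det (matrix (reflect :: real^'n \<Rightarrow> real^'n))
      = (\<Prod>i\<in>UNIV. matrix (reflect :: real^'n \<Rightarrow> real^'n) $ i $ i)"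
    by (rule det_diagonal) (auto simp: matrix_def axis_def reflect_def)
  also have "\<dots> = (\<Prod>i\<in>UNIV. if i = (SOME i::'n. True) then -1 else 1)"
    by (rule prod.cong) (auto simp: matrix_def axis_def reflect_def)
  finally show ?thesis by simp
qed

lemma signed_smooth_reflect:
  "open S \<Longrightarrow> signed_smooth (-1) S (\<lambda>x. reflect x + c)"
  by (rule signed_smooth_affine) (auto simp: linear_reflect det_reflect)

text \<open>The gluing map seen from a reflected disc. The two reversals of orientation cancel, and the
  map is an involution of the punctured ball.\<close>

definition neck :: "real^'n::finite \<Rightarrow> real^'n" where
  "neck x = radial_flip (reflect x)"

lemma reflect_punctured_ball: "reflect x \<in> punctured_ball \<longleftrightarrow> x \<in> punctured_ball"
proof -
  have "reflect x = 0 \<longleftrightarrow> x = 0" using norm_reflect[of x] by (metis norm_eq_zero)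
  then show ?thesis by simp
qed

lemma neck_in: "x \<in> punctured_ball \<Longrightarrow> neck x \<in> punctured_ball"
  unfolding neck_def by (intro radial_flip_in iffD2[OF reflect_punctured_ball])

lemma norm_neck: "x \<in> punctured_ball \<Longrightarrow> norm (neck x) = 1 - norm x"
  unfolding neck_def by (subst norm_radial_flip[OF iffD2[OF reflect_punctured_ball]]) auto

lemma neck_neck:
  fixes x :: "real^'n::finite"
  assumes "x \<in> punctured_ball" shows "neck (neck x) = x"
proof -
  have "reflect (radial_flip y) = radial_flip (reflect y)" for y :: "real^'n"
    using linear_scale[OF linear_reflect] by (simp add: radial_flip_def)
  then show ?thesis
    using radial_flip_involution[OF assms] by (simp add: neck_def)
qed

lemma signed_smooth_neck: "signed_smooth 1 punctured_ball (neck :: real^'n::finite \<Rightarrow> real^'n)"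
proof -
  have o: "open (punctured_ball :: (real^'n) set)" by (simp add: open_Diff)
  have 1: "signed_smooth (-1) punctured_ball (reflect :: real^'n \<Rightarrow> real^'n)"
    using signed_smooth_reflect[OF o, of 0] by simp
  have "signed_smooth (-1 * -1) punctured_ball (radial_flip \<circ> reflect :: real^'n \<Rightarrow> real^'n)"
    by (rule signed_smooth_compose[OF o o _ 1 signed_smooth_radial_flip])
       (intro image_subsetI iffD2[OF reflect_punctured_ball])
  moreover have "(radial_flip \<circ> reflect :: real^'n \<Rightarrow> real^'n) = neck" by (auto simp: neck_def)
  ultimately show ?thesis by simp
qed

section \<open>Existence of discs\<close>

lemma signed_embedding_affine:
  fixes L :: "real^'n::finite \<Rightarrow> real^'n"
  assumes S: "open S" and T: "open T" and L: "linear L" "linear L'" "\<And>x. L' (L x) = x" "\<And>x. L (L' x) = x"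
    and s: "s * det (matrix L) > 0" "s * det (matrix L') > 0"
    and sub: "(\<lambda>x. L x + c) ` S \<subseteq> T"
  shows "signed_embedding s (euclidean_piece S) (euclidean_piece T) (\<lambda>x. L x + c)"
proof (rule signed_embeddingI[OF charted_euclidean_piece[OF S] charted_euclidean_piece[OF T]])
  show "signed_smooth_on s (euclidean_piece S) (euclidean_piece T)
      (topspace (mtop (euclidean_piece S))) (\<lambda>x. L x + c)"
    using signed_smooth_on_euclidean[OF S T S _ _ signed_smooth_affine[OF S L(1) s(1)]] sub by simp
  let ?g = "\<lambda>y. L' y + (- L' c)"
  have g: "?g (L x + c) = x" for x
    using L by (simp add: linear_add)
  have "(\<lambda>x. L x + c) ` S = ?g -` S"
  proof
    show "?g -` S \<subseteq> (\<lambda>x. L x + c) ` S"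
    proof
      fix y assume "y \<in> ?g -` S"
      moreover have "y = L (?g y) + c" using L by (simp add: linear_add linear_diff)
      ultimately show "y \<in> (\<lambda>x. L x + c) ` S" by blast
    qed
  qed (use g in auto)
  moreover have "continuous_on UNIV ?g"
    using L(2) by (intro continuous_intros linear_continuous_on) (simp add: linear_conv_bounded_linear)
  ultimately have o: "open ((\<lambda>x. L x + c) ` S)"
    using open_vimage[OF S] by metis
  show "signed_smooth_on s (euclidean_piece T) (euclidean_piece S)
      ((\<lambda>x. L x + c) ` topspace (mtop (euclidean_piece S))) ?g"
    unfolding topspace_euclidean_piece
    by (rule signed_smooth_on_euclidean[OF T S o sub _ signed_smooth_affine[OF o L(2) s(2)]])
       (use g in auto)
qed (use L in \<open>simp add: linear_add\<close>)

text \<open>A small ball in the image of a chart, rescaled to radius 2.\<close>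

lemma oriented_disc_exists:
  fixes M :: "('a, 'n::finite) atlas_space"
  assumes M: "oriented_smooth_manifold M" and ne: "topspace (mtop M) \<noteq> {}"
  obtains i where "signed_embedding 1 (euclidean_piece (ball 0 2)) M i"
proof -
  have ch: "charted M" and id: "signed_smooth_on 1 M M (topspace (mtop M)) id"
    using M by (auto simp: oriented_smooth_manifold_iff)
  obtain p V \<phi> where V: "(V, \<phi>) \<in> atlas M" "p \<in> V"
    using ne chartedE[OF ch] by (metis ex_in_conv)
  have o: "open (\<phi> ` V)"
    by (rule chart_open_image[OF ch V(1) chart_openin[OF ch V(1)]]) simp
  then obtain r where r: "r > 0" "ball (\<phi> p) r \<subseteq> \<phi> ` V"
    using V(2) by (metis imageI open_contains_ball)
  have inj: "inj_on \<phi> V" by (rule chart_inj[OF ch V(1)])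
  have det: "det (matrix (\<lambda>x :: real^'n. c *\<^sub>R x)) > 0" if "c > 0" for c
  proof -
    have "det (matrix (\<lambda>x :: real^'n. c *\<^sub>R x)) = (\<Prod>i\<in>UNIV. matrix (\<lambda>x :: real^'n. c *\<^sub>R x) $ i $ i)"
      by (rule det_diagonal) (auto simp: matrix_def axis_def)
    then show ?thesis using that by (simp add: matrix_def axis_def)
  qed
  have lin: "linear (\<lambda>x :: real^'n. c *\<^sub>R x)" for c
    by (rule linearI) (auto simp: algebra_simps)
  have 1: "signed_embedding 1 (euclidean_piece (ball 0 2)) (euclidean_piece (\<phi> ` V))
      (\<lambda>x. (r / 2) *\<^sub>R x + \<phi> p)"
  proof (rule signed_embedding_affine[where L' = "\<lambda>x. (2 / r) *\<^sub>R x", OF _ o lin lin])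
    have "(r / 2) *\<^sub>R x + \<phi> p \<in> ball (\<phi> p) r" if "x \<in> ball 0 2" for x
      using that r(1) by (simp add: dist_norm)
    then show "(\<lambda>x. (r / 2) *\<^sub>R x + \<phi> p) ` ball 0 2 \<subseteq> \<phi> ` V" using r(2) by auto
  qed (use det r(1) in auto)
  have 2: "signed_embedding 1 (euclidean_piece (\<phi> ` V)) M (inv_into V \<phi>)"
  proof (rule signed_embeddingI[OF charted_euclidean_piece[OF o] ch])
    show "signed_smooth_on 1 (euclidean_piece (\<phi> ` V)) M (topspace (mtop (euclidean_piece (\<phi> ` V))))
        (inv_into V \<phi>)"
      using chart_signed_smooth_on(2)[OF ch id V(1)] by simp
    have "inv_into V \<phi> ` \<phi> ` V = V" using inj by simp
    then show "signed_smooth_on 1 M (euclidean_piece (\<phi> ` V))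
        (inv_into V \<phi> ` topspace (mtop (euclidean_piece (\<phi> ` V)))) \<phi>"
      using chart_signed_smooth_on(1)[OF ch id V(1)] by simp
  qed (auto simp: f_inv_into_f)
  from signed_embedding_compose[OF charted_euclidean_piece charted_euclidean_piece[OF o] ch 1 2]
  show thesis using that by auto
qed

section \<open>The sum of Euclidean space with infinitely many copies of a manifold\<close>

lemma signed_smooth_on_empty: "signed_smooth_on s M N {} f"
proof -
  have "Ck_on k {} g" for k and g :: "real^'n::finite \<Rightarrow> real^'n"
    by (induction k arbitrary: g) auto
  then show ?thesis
    by (intro signed_smooth_onI) (auto simp: signed_smooth_def smooth_on_def)
qed

text \<open>The transition from a piece to itself is the identity.\<close>

lemma self_transition:
  assumes A: "charted A" and id: "signed_smooth_on 1 A A (topspace (mtop A)) id"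
    and F: "inj_on F (topspace (mtop A))"
  shows "signed_smooth_on 1 A A (topspace (mtop A) \<inter> F -` F ` topspace (mtop A))
      (inv_into (topspace (mtop A)) F \<circ> F)"
proof -
  have "topspace (mtop A) \<inter> F -` F ` topspace (mtop A) = topspace (mtop A)" by auto
  then show ?thesis
    using signed_smooth_on_transform[OF A A id] F by simp
qed

lemma signed_smooth_on_id_euclidean_piece:
  assumes "open S"
  shows "signed_smooth_on 1 (euclidean_piece S) (euclidean_piece S) S id"
  using signed_smooth_on_euclidean[OF assms assms assms, of "\<lambda>x. x + 0" 1]
    signed_smooth_translation[OF assms, of 0] by (simp add: id_def)

text \<open>Data for the construction of \<open>\<real>\<^sup>n # M # M # \<dots>\<close> on the type of points of \<open>M\<close>: the disc \<open>i\<close>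
  at which all sums are taken, an injection \<open>h\<close> that encodes the points of \<open>\<real>\<^sup>n\<close>, and an
  injection \<open>J\<close> that encodes the disjoint union of \<open>\<real>\<^sup>n\<close> (tag \<open>None\<close>) and of the copies of
  \<open>M\<close> (tags \<open>Some m\<close>).\<close>

locale infinite_connected_sum =
  fixes M :: "('a, 'n::finite) atlas_space" and i :: "real^'n \<Rightarrow> 'a"
    and h :: "real^'n \<Rightarrow> 'a" and J :: "nat option \<times> 'a \<Rightarrow> 'a"
  assumes manifold: "oriented_smooth_manifold M"
    and connected: "connected_space (mtop M)"
    and disc: "signed_embedding 1 (euclidean_piece (ball 0 2)) M i"
    and inj_h: "inj h" and inj_J: "inj J"
    and dim: "CARD('n) \<ge> 2"
begin

text \<open>The length 4 makes the balls of radius 2 around different centres disjoint.\<close>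

definition step :: "real^'n" where
  "step = 4 *\<^sub>R axis (SOME k. True) 1"

definition centre :: "nat \<Rightarrow> real^'n" where
  "centre m = real m *\<^sub>R step"

definition plane :: "(real^'n) set" where
  "plane = - range centre"

text \<open>The maps \<open>copy m\<close> and \<open>base\<close> send the points of the \<open>m\<close>-th copy of \<open>M\<close> and of \<open>\<real>\<^sup>n\<close> to the
  points of the infinite sum. A point of \<open>\<real>\<^sup>n\<close> in the punctured unit ball around a centre is
  identified with a point of the copy of \<open>M\<close> attached there, and the latter represents both.\<close>

definition copy :: "nat \<Rightarrow> 'a \<Rightarrow> 'a" where
  "copy m y = J (Some m, y)"

definition base :: "real^'n \<Rightarrow> 'a" where
  "base x = (if \<exists>m. x - centre m \<in> punctured_ball
     then let m = (SOME m. x - centre m \<in> punctured_ball) in copy m (i (neck (x - centre m)))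
     else J (None, h x))"

lemma norm_step [simp]: "norm step = 4"
  by (simp add: step_def)

lemma centre_Suc: "centre (Suc m) = centre m + step"
  by (simp add: centre_def algebra_simps)

lemma centre_apart:
  assumes "norm (x - centre m) < 2" "norm (x - centre m') < 2"
  shows "m = m'"
proof (rule ccontr)
  assume "m \<noteq> m'"
  then have "\<bar>real m - real m'\<bar> \<ge> 1" by linarith
  moreover have "norm (centre m - centre m') = \<bar>real m - real m'\<bar> * 4"
    unfolding centre_def scaleR_left_diff_distrib[symmetric] by simp
  moreover have "norm (centre m - centre m') \<le> norm (x - centre m') + norm (x - centre m)"
    using norm_triangle_ineq4[of "x - centre m'" "x - centre m"] by simp
  ultimately have "4 \<le> norm (x - centre m') + norm (x - centre m)" by simp
  then show False using assms by linarith
qed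

lemma open_plane: "open plane"
proof -
  have "closed (range centre)"
  proof (rule discrete_imp_closed[of 1])
    show "\<forall>x\<in>range centre. \<forall>y\<in>range centre. dist y x < 1 \<longrightarrow> y = x"
    proof (intro ballI impI)
      fix x y assume "x \<in> range centre" "y \<in> range centre" "dist y x < 1"
      then obtain m m' where "x = centre m" "y = centre m'" "norm (centre m' - centre m) < 1"
        by (auto simp: dist_norm)
      then show "y = x" using centre_apart[of "centre m'" m m'] by simp
    qed
  qed simp
  then show ?thesis by (simp add: plane_def open_Compl)
qed

lemma near_centre_in_plane:
  assumes "z \<in> punctured_ball"
  shows "z + centre m \<in> plane"
proof -
  have "z + centre m \<noteq> centre m'" for m'
  proof
    assume "z + centre m = centre m'"
    then have "m = m'" using assms centre_apart[of "centre m'" m m']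
      by (simp add: algebra_simps) (metis add_diff_cancel_right' less_trans one_less_numeral_iff semiring_norm(76))
    then show False using assms \<open>z + centre m = centre m'\<close> by simp
  qed
  then show ?thesis by (auto simp: plane_def)
qed

lemma copy_eq: "copy m x = copy m' y \<longleftrightarrow> m = m' \<and> x = y"
  using injD[OF inj_J] by (auto simp: copy_def)

lemma base_near_centre:
  assumes "x - centre m \<in> punctured_ball"
  shows "base x = copy m (i (neck (x - centre m)))"
proof -
  have "(SOME m. x - centre m \<in> punctured_ball) = m"
  proof (rule some_equality[of _ m])
    fix m' assume "x - centre m' \<in> punctured_ball"
    then show "m' = m" using assms by (intro centre_apart[of x]) auto
  qed (rule assms)
  moreover have "\<exists>m. x - centre m \<in> punctured_ball" using assms by blast
  ultimately show ?thesis unfolding base_def by (simp only: if_True Let_def)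
qed

lemma base_eq_copy:
  "base x = copy m y \<longleftrightarrow> x - centre m \<in> punctured_ball \<and> y = i (neck (x - centre m))"
proof (cases "\<exists>m'. x - centre m' \<in> punctured_ball")
  case True
  then obtain m' where m': "x - centre m' \<in> punctured_ball" by blast
  have "x - centre m \<in> punctured_ball \<Longrightarrow> m' = m"
    using m' by (intro centre_apart[of x]) auto
  then show ?thesis using base_near_centre[OF m'] m' by (auto simp: copy_eq)
next
  case False
  then have "base x = J (None, h x)" unfolding base_def by (simp only: if_False)
  then have "base x \<noteq> copy m y" using injD[OF inj_J] by (auto simp: copy_def)
  then show ?thesis using False by blast
qed

lemma inj_i: "inj_on i (ball 0 2)"
  using signed_embeddingD(1)[OF disc] by simp

lemma i_eq: "norm x < 2 \<Longrightarrow> norm y < 2 \<Longrightarrow> i x = i y \<longleftrightarrow> x = y"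
  using inj_onD[OF inj_i, of x y] by auto

lemma i_in: "norm x < 2 \<Longrightarrow> i x \<in> topspace (mtop M)"
  using signed_smooth_onD(2)[OF signed_embeddingD(2)[OF disc], of x] by simp

lemma neck_inj: "x \<in> punctured_ball \<Longrightarrow> y \<in> punctured_ball \<Longrightarrow> neck x = neck y \<longleftrightarrow> x = y"
  using neck_neck by metis

lemma inj_base: "inj base"
proof (rule injI)
  fix x y assume eq: "base x = base y"
  show "x = y"
  proof (cases "\<exists>m. x - centre m \<in> punctured_ball")
    case True
    then obtain m where m: "x - centre m \<in> punctured_ball" by blast
    then have y: "y - centre m \<in> punctured_ball" "i (neck (x - centre m)) = i (neck (y - centre m))"
      using base_near_centre[OF m] eq base_eq_copy[of y m] by auto
    then have "neck (x - centre m) = neck (y - centre m)"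
      using neck_in[OF m] neck_in[OF y(1)] i_eq by auto
    then show ?thesis using neck_inj[OF m y(1)] by simp
  next
    case False
    have "\<not> (\<exists>m. y - centre m \<in> punctured_ball)"
    proof
      assume "\<exists>m. y - centre m \<in> punctured_ball"
      then obtain m where m: "y - centre m \<in> punctured_ball" by blast
      show False using base_near_centre[OF m] eq base_eq_copy[of x m] False by auto
    qed
    then have "J (None, h x) = J (None, h y)"
      using eq False unfolding base_def by (simp only: if_False)
    then show ?thesis using injD[OF inj_J] injD[OF inj_h] by blast
  qed
qed

lemma charted_M: "charted M" and id_M: "signed_smooth_on 1 M M (topspace (mtop M)) id"
  and Hausdorff_M: "Hausdorff_space (mtop M)" and second_countable_M: "second_countable (mtop M)"
  using manifold by (auto simp: oriented_smooth_manifold_iff)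

abbreviation summand :: "('a, 'n) atlas_space" where
  "summand \<equiv> puncture M (i 0)"

lemma topspace_summand [simp]: "topspace (mtop summand) = topspace (mtop M) - {i 0}"
  by (auto simp: puncture_def)

lemma open_summand: "openin (mtop M) (topspace (mtop M) - {i 0})"
  using closedin_Hausdorff_singleton[OF Hausdorff_M i_in[of 0]] by (simp add: openin_diff)

lemma openin_summand: "openin (mtop summand) W \<longleftrightarrow> openin (mtop M) W \<and> W \<subseteq> topspace (mtop M) - {i 0}"
  unfolding puncture_def by (rule openin_open_submanifold[OF open_summand])

lemma charted_summand: "charted summand"
  unfolding puncture_def by (rule charted_open_submanifold[OF charted_M open_summand])

lemma id_summand: "signed_smooth_on 1 summand summand (topspace (mtop summand)) id"
  using signed_smooth_on_id_open_submanifold[OF charted_M open_summand id_M]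
  unfolding topspace_summand unfolding puncture_def .

lemma disc_in_summand: "z \<in> punctured_ball \<Longrightarrow> i z \<in> topspace (mtop M) - {i 0}"
  using i_in[of z] i_eq[of z 0] by auto

text \<open>All pieces of a glued space share one type of points, so the punctured \<open>\<real>\<^sup>n\<close> is first
  transported along \<open>h\<close>.\<close>

definition coded_plane :: "('a, 'n) atlas_space" where
  "coded_plane = glue (\<lambda>_::unit. euclidean_piece plane) (\<lambda>_. h)"

sublocale plane_code: gluing_data "\<lambda>_::unit. euclidean_piece plane" "\<lambda>_. h"
proof
  show E: "charted (euclidean_piece plane)" by (rule charted_euclidean_piece[OF open_plane])
  show inj: "inj_on h (topspace (mtop (euclidean_piece plane)))" by (rule inj_on_subset[OF inj_h]) simp
  show "signed_smooth_on 1 (euclidean_piece plane) (euclidean_piece plane)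
      (topspace (mtop (euclidean_piece plane)) \<inter> h -` h ` topspace (mtop (euclidean_piece plane)))
      (inv_into (topspace (mtop (euclidean_piece plane))) h \<circ> h)"
    by (rule self_transition[OF E _ inj])
       (use signed_smooth_on_id_euclidean_piece[OF open_plane] in simp)
qed

lemma charted_coded_plane: "charted coded_plane"
  unfolding coded_plane_def by (rule plane_code.charted_glue)

lemma topspace_coded_plane [simp]: "topspace (mtop coded_plane) = h ` plane"
  by (simp add: coded_plane_def topspace_glue)

lemma embedding_h: "signed_embedding 1 (euclidean_piece plane) coded_plane h"
  unfolding coded_plane_def by (rule plane_code.signed_embedding_piece)

primrec piece :: "nat option \<Rightarrow> ('a, 'n) atlas_space" where
  "piece None = coded_plane"
| "piece (Some m) = summand"

primrec attach :: "nat option \<Rightarrow> 'a \<Rightarrow> 'a" where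
  "attach None = base \<circ> inv h"
| "attach (Some m) = copy m"

lemma inv_h [simp]: "inv h (h x) = x"
  by (rule inv_f_f[OF inj_h])

lemma inv_into_h [simp]: "x \<in> plane \<Longrightarrow> inv_into plane h (h x) = x"
  by (rule inv_into_f_f[OF inj_on_subset[OF inj_h]]) auto

lemma inj_attach: "inj_on (attach k) (topspace (mtop (piece k)))"
  by (cases k) (auto simp: inj_on_def copy_eq dest: injD[OF inj_base])

lemma inv_copy: "x \<in> topspace (mtop summand) \<Longrightarrow> inv_into (topspace (mtop summand)) (copy m) (copy m x) = x"
  by (rule inv_into_f_f) (auto simp: inj_on_def copy_eq)

lemma inv_base: "x \<in> plane \<Longrightarrow> inv_into (h ` plane) (base \<circ> inv h) (base x) = h x"
  using inv_into_f_f[OF inj_attach[of None], of "h x"] by simp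

lemma open_punctured_ball: "open (punctured_ball :: (real^'n) set)"
  by (rule open_Diff) auto

lemma open_near_centre: "open {x. x - centre m \<in> punctured_ball}"
proof -
  have "continuous_on UNIV (\<lambda>x. x - centre m)" by (intro continuous_intros)
  from open_vimage[OF open_punctured_ball this] show ?thesis by (simp add: vimage_def)
qed

lemma near_centre_plane: "{x. x - centre m \<in> punctured_ball} \<subseteq> plane"
proof
  fix x assume "x \<in> {x. x - centre m \<in> punctured_ball}"
  then show "x \<in> plane" using near_centre_in_plane[of "x - centre m" m] by simp
qed

text \<open>The transition decodes a point near \<open>centre m\<close>, moves the centre to the origin, and applies
  the neck and the disc \<open>i\<close>, all of which preserve orientation.\<close>

lemma transition_plane_copy:
  "signed_smooth_on 1 coded_plane summand (h ` plane \<inter> (base \<circ> inv h) -` copy m ` topspace (mtop summand))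
     (inv_into (topspace (mtop summand)) (copy m) \<circ> (base \<circ> inv h))"
proof -
  let ?D = "{x. x - centre m \<in> punctured_ball}" and ?B = "ball 0 2 :: (real^'n) set"
  let ?t = "neck \<circ> (\<lambda>x. x + - centre m)"
  have E: "charted (euclidean_piece plane)" "charted (euclidean_piece ?B)"
    by (rule charted_euclidean_piece, simp add: open_plane)+
  have oD: "openin (mtop (euclidean_piece plane)) ?D"
    using open_near_centre near_centre_plane by (simp add: openin_euclidean_piece open_plane)
  have "signed_smooth (1 * 1) ?D ?t"
    by (rule signed_smooth_compose[OF open_near_centre open_punctured_ball _
          signed_smooth_translation[OF open_near_centre] signed_smooth_neck]) auto
  then have t: "signed_smooth_on 1 (euclidean_piece plane) (euclidean_piece ?B) ?D ?t"
    using neck_in by (intro signed_smooth_on_euclidean open_plane open_near_centre near_centre_plane) fastforce+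
  have 1: "signed_smooth_on 1 coded_plane (euclidean_piece plane) (h ` ?D) (inv_into plane h)"
    using signed_embedding_inv_on[OF embedding_h oD] by simp
  have "signed_smooth_on (1 * 1) coded_plane (euclidean_piece ?B) (h ` ?D) (?t \<circ> inv_into plane h)"
    by (rule signed_smooth_on_compose[OF charted_coded_plane E 1 t])
       (use near_centre_plane in \<open>auto simp: subset_iff\<close>)
  then have 2: "signed_smooth_on 1 coded_plane (euclidean_piece ?B) (h ` ?D) (?t \<circ> inv_into plane h)"
    by simp
  have val: "(?t \<circ> inv_into plane h) (h x) = neck (x - centre m)" if "x \<in> ?D" for x
    using that near_centre_plane by (auto simp: subset_iff)
  have "signed_smooth_on (1 * 1) coded_plane M (h ` ?D) (i \<circ> (?t \<circ> inv_into plane h))"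
  proof (rule signed_smooth_on_compose[OF charted_coded_plane E(2) charted_M 2 signed_embeddingD(2)[OF disc]])
    show "(?t \<circ> inv_into plane h) ` h ` ?D \<subseteq> topspace (mtop (euclidean_piece ?B))"
    proof (intro image_subsetI)
      fix w assume "w \<in> h ` ?D"
      then obtain x where x: "w = h x" "x \<in> ?D" by (rule imageE)
      then have "neck (x - centre m) \<in> punctured_ball" by (intro neck_in) (rule CollectD)
      then show "(?t \<circ> inv_into plane h) w \<in> topspace (mtop (euclidean_piece ?B))"
        unfolding x(1) val[OF x(2)] by simp
    qed
  qed
  moreover have "(i \<circ> (?t \<circ> inv_into plane h)) ` h ` ?D \<subseteq> topspace (mtop M) - {i 0}"
  proof (intro image_subsetI)
    fix w assume "w \<in> h ` ?D"
    then obtain x where x: "w = h x" "x \<in> ?D" by (rule imageE)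
    have "(i \<circ> (?t \<circ> inv_into plane h)) w = i (neck (x - centre m))"
      using val[OF x(2)] x(1) by (simp only: o_apply)
    then show "(i \<circ> (?t \<circ> inv_into plane h)) w \<in> topspace (mtop M) - {i 0}"
      using disc_in_summand[OF neck_in[OF CollectD[OF x(2)]]] by (simp only:)
  qed
  ultimately have 3: "signed_smooth_on 1 coded_plane summand (h ` ?D) (i \<circ> (?t \<circ> inv_into plane h))"
    unfolding puncture_def mult_1 by (rule signed_smooth_on_into_open_submanifold[OF open_summand])
  have W: "h ` plane \<inter> (base \<circ> inv h) -` copy m ` topspace (mtop summand) = h ` ?D"
  proof (intro equalityI subsetI)
    fix w assume "w \<in> h ` plane \<inter> (base \<circ> inv h) -` copy m ` topspace (mtop summand)"
    then obtain x where x: "w = h x" and w: "(base \<circ> inv h) w \<in> copy m ` topspace (mtop summand)"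
      by blast
    from w obtain y where "base x = copy m y" unfolding x by auto
    then show "w \<in> h ` ?D" using base_eq_copy x by blast
  next
    fix w assume "w \<in> h ` ?D"
    then obtain x where x: "w = h x" "x - centre m \<in> punctured_ball" by blast
    then show "w \<in> h ` plane \<inter> (base \<circ> inv h) -` copy m ` topspace (mtop summand)"
      using base_near_centre[OF x(2)] disc_in_summand[OF neck_in[OF x(2)]] near_centre_plane[of m] by auto
  qed
  show ?thesis
    unfolding W
  proof (rule signed_smooth_on_transform[OF charted_coded_plane charted_summand 3])
    fix w assume "w \<in> h ` ?D"
    then obtain x where x: "w = h x" "x - centre m \<in> punctured_ball" by blast
    show "(i \<circ> (?t \<circ> inv_into plane h)) w = (inv_into (topspace (mtop summand)) (copy m) \<circ> (base \<circ> inv h)) w"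
      using x val[of x] base_near_centre[OF x(2)] inv_copy[of "i (neck (x - centre m))" m]
        disc_in_summand[OF neck_in[OF x(2)]] by simp
  qed
qed

text \<open>As the neck is an involution, this is the composite of the same maps in reverse order.\<close>

lemma transition_copy_plane:
  "signed_smooth_on 1 summand coded_plane (topspace (mtop summand) \<inter> copy m -` (base \<circ> inv h) ` h ` plane)
     (inv_into (h ` plane) (base \<circ> inv h) \<circ> copy m)"
proof -
  let ?B = "ball 0 2 :: (real^'n) set" and ?t = "(\<lambda>x. x + centre m) \<circ> neck"
  let ?P = "punctured_ball :: (real^'n) set"
  have PB: "?P \<subseteq> ?B" by auto
  have E: "charted (euclidean_piece ?B)" "charted (euclidean_piece plane)"
    by (rule charted_euclidean_piece, simp add: open_plane)+
  have oP: "openin (mtop (euclidean_piece ?B)) ?P"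
    using open_punctured_ball PB by (simp add: openin_euclidean_piece)
  have "signed_smooth (1 * 1) ?P ?t"
    by (rule signed_smooth_compose[OF open_punctured_ball open_UNIV _
          signed_smooth_neck signed_smooth_translation[OF open_UNIV]]) auto
  moreover have "?t ` ?P \<subseteq> plane"
    using near_centre_in_plane[OF neck_in] by (intro image_subsetI) (simp only: o_apply)
  ultimately have t: "signed_smooth_on 1 (euclidean_piece ?B) (euclidean_piece plane) ?P ?t"
    by (intro signed_smooth_on_euclidean open_plane open_punctured_ball PB) auto
  have inv: "inv_into ?B i (i z) = z" if "z \<in> ?P" for z
    using inv_into_f_f[OF inj_i] that PB by blast
  have iP: "i ` ?P \<subseteq> topspace (mtop M) - {i 0}"
    by (intro image_subsetI) (rule disc_in_summand)
  have 1: "signed_smooth_on 1 summand (euclidean_piece ?B) (i ` ?P) (inv_into ?B i)"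
    unfolding puncture_def
    by (rule signed_smooth_on_from_open_submanifold[OF charted_M E(1) open_summand _ iP])
       (use signed_embedding_inv_on[OF disc oP] in simp)
  have "signed_smooth_on (1 * 1) summand (euclidean_piece plane) (i ` ?P) (?t \<circ> inv_into ?B i)"
    by (rule signed_smooth_on_compose[OF charted_summand E 1 t])
       (intro image_subsetI, elim imageE, simp only: inv)
  then have 2: "signed_smooth_on 1 summand (euclidean_piece plane) (i ` ?P) (?t \<circ> inv_into ?B i)" by simp
  have "signed_smooth_on (1 * 1) summand coded_plane (i ` ?P) (h \<circ> (?t \<circ> inv_into ?B i))"
    by (rule signed_smooth_on_compose[OF charted_summand E(2) charted_coded_plane 2 signed_embeddingD(2)[OF embedding_h]])
       (intro image_subsetI, elim imageE, simp only: o_apply inv topspace_euclidean_piece near_centre_in_plane[OF neck_in])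
  then have 3: "signed_smooth_on 1 summand coded_plane (i ` ?P) (h \<circ> (?t \<circ> inv_into ?B i))" by simp
  have copy_i: "copy m (i z) = base (neck z + centre m)" if "z \<in> ?P" for z
    using base_near_centre[of "neck z + centre m" m] neck_in[OF that] neck_neck[OF that] by simp
  have W: "topspace (mtop summand) \<inter> copy m -` (base \<circ> inv h) ` h ` plane = i ` ?P"
  proof (intro equalityI subsetI)
    fix y assume "y \<in> topspace (mtop summand) \<inter> copy m -` (base \<circ> inv h) ` h ` plane"
    then obtain x where "base x = copy m y" by auto
    then show "y \<in> i ` ?P" using neck_in base_eq_copy by blast
  next
    fix y assume "y \<in> i ` ?P"
    then obtain z where z: "y = i z" "z \<in> ?P" by blast
    then have "copy m y \<in> base ` plane" using copy_i near_centre_in_plane[OF neck_in] by blast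
    then show "y \<in> topspace (mtop summand) \<inter> copy m -` (base \<circ> inv h) ` h ` plane"
      using disc_in_summand[OF z(2)] z(1) by (simp add: image_image)
  qed
  show ?thesis
    unfolding W
  proof (rule signed_smooth_on_transform[OF charted_summand charted_coded_plane 3])
    fix y assume "y \<in> i ` ?P"
    then obtain z where z: "y = i z" "z \<in> ?P" by blast
    show "(h \<circ> (?t \<circ> inv_into ?B i)) y = (inv_into (h ` plane) (base \<circ> inv h) \<circ> copy m) y"
      using inv[OF z(2)] copy_i[OF z(2)] inv_base[OF near_centre_in_plane[OF neck_in[OF z(2)]]]
      by (simp only: z(1) o_apply)
  qed
qed

sublocale gluing_data piece attach
proof
  have pc: "charted (piece k)" for k
    by (cases k) (simp_all add: charted_coded_plane charted_summand)
  then show "charted (piece k)" for k .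
  show "inj_on (attach k) (topspace (mtop (piece k)))" for k by (rule inj_attach)
  have id: "signed_smooth_on 1 (piece k) (piece k) (topspace (mtop (piece k))) id" for k
    using id_summand plane_code.signed_smooth_on_id_glue
    by (cases k) (simp_all only: piece.simps coded_plane_def)
  fix k l
  show "signed_smooth_on 1 (piece k) (piece l)
      (topspace (mtop (piece k)) \<inter> attach k -` attach l ` topspace (mtop (piece l)))
      (inv_into (topspace (mtop (piece l))) (attach l) \<circ> attach k)"
  proof (cases "k = l")
    case True
    then show ?thesis using self_transition[OF pc id inj_attach] by simp
  next
    case False
    show ?thesis
    proof (cases k)
      case None
      then obtain m where "l = Some m" using False by (cases l) auto
      then show ?thesis using transition_plane_copy[of m] None by simp
    next
      case k: (Some m)
      show ?thesis
      proof (cases l)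
        case None
        then show ?thesis using transition_copy_plane[of m] k by simp
      next
        case (Some m')
        then have "topspace (mtop (piece k)) \<inter> attach k -` attach l ` topspace (mtop (piece l)) = {}"
          using k False by (auto simp: copy_eq)
        then show ?thesis by (simp only: signed_smooth_on_empty)
      qed
    qed
  qed
qed

definition total :: "('a, 'n) atlas_space" where
  "total = glue piece attach"

lemma charted_total: "charted total"
  unfolding total_def by (rule charted_glue)

lemma embedding_copy: "signed_embedding 1 summand total (copy m)"
  unfolding total_def using signed_embedding_piece[of "Some m"] by simp

lemma embedding_base: "signed_embedding 1 (euclidean_piece plane) total base"
proof -
  have E: "charted (euclidean_piece plane)" by (rule charted_euclidean_piece[OF open_plane])
  have "signed_embedding 1 coded_plane total (base \<circ> inv h)"
    unfolding total_def using signed_embedding_piece[of None] by simp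
  from signed_embedding_compose[OF E charted_coded_plane charted_total embedding_h this]
  have "signed_embedding 1 (euclidean_piece plane) total (base \<circ> inv h \<circ> h)" by simp
  then show ?thesis by (rule signed_embedding_transform[OF E charted_total]) simp
qed

lemma topspace_total: "topspace (mtop total) = base ` plane \<union> (\<Union>m. copy m ` (topspace (mtop M) - {i 0}))"
  by (simp add: total_def topspace_glue UNIV_option_conv image_image image_comp)

end

section \<open>Separation, countability and connectedness of the infinite sum\<close>

lemma (in gluing_data) second_countable_glue:
  assumes "countable (UNIV :: 'k set)" "\<And>k. second_countable (mtop (A k))"
  shows "second_countable (mtop (glue A F))"
proof -
  have "\<forall>k. \<exists>\<B>. countable \<B> \<and> (\<forall>V\<in>\<B>. openin (mtop (A k)) V) \<and>
      (\<forall>U x. openin (mtop (A k)) U \<and> x \<in> U \<longrightarrow> (\<exists>V\<in>\<B>. x \<in> V \<and> V \<subseteq> U))"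
    using assms(2) unfolding second_countable_def by blast
  then obtain \<B> where \<B>: "\<And>k. countable (\<B> k)" "\<And>k V. V \<in> \<B> k \<Longrightarrow> openin (mtop (A k)) V"
    "\<And>k U x. openin (mtop (A k)) U \<Longrightarrow> x \<in> U \<Longrightarrow> \<exists>V\<in>\<B> k. x \<in> V \<and> V \<subseteq> U"
    by metis
  have base: "\<exists>V\<in>(\<Union>k. image (F k) ` \<B> k). x \<in> V \<and> V \<subseteq> U"
    if U: "openin (mtop (glue A F)) U" "x \<in> U" for U x
  proof -
    obtain k a where a: "a \<in> topspace (mtop (A k))" "x = F k a"
      using openin_subset[OF U(1)] U(2) by (auto simp: topspace_glue)
    then obtain V where "V \<in> \<B> k" "a \<in> V" "V \<subseteq> topspace (mtop (A k)) \<inter> F k -` U"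
      using \<B>(3)[OF glue_continuous[OF U(1), of k], of a] U(2) by auto
    then show ?thesis using a by (intro bexI[of _ "F k ` V"]) auto
  qed
  have "countable (\<Union>k. image (F k) ` \<B> k)"
    using assms(1) \<B>(1) by auto
  then show ?thesis
    unfolding second_countable_def using base \<B>(2) glue_open_map
    by (intro exI[of _ "\<Union>k. image (F k) ` \<B> k"]) auto
qed

context infinite_connected_sum
begin

lemma second_countable_total: "second_countable (mtop total)"
  unfolding total_def
proof (rule second_countable_glue)
  have E: "second_countable (top_of_set S)" for S :: "(real^'n) set"
  proof (rule second_countable_subtopology)
    obtain B :: "(real^'n) set set" where B: "countable B" "\<And>C. C \<in> B \<Longrightarrow> open C"
      "\<And>S. open S \<Longrightarrow> \<exists>U. U \<subseteq> B \<and> S = \<Union>U"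
      using univ_second_countable by blast
    show "second_countable (euclidean :: (real^'n) topology)"
      unfolding second_countable_def
    proof (intro exI[of _ B] conjI ballI allI impI)
      fix U :: "(real^'n) set" and x assume "openin euclidean U \<and> x \<in> U"
      then have "open U" "x \<in> U" by auto
      with B(3)[of U] obtain \<U> where "\<U> \<subseteq> B" "U = \<Union>\<U>" by blast
      with \<open>x \<in> U\<close> show "\<exists>V\<in>B. x \<in> V \<and> V \<subseteq> U" by blast
    qed (use B in auto)
  qed
  then have "second_countable (mtop coded_plane)"
    unfolding coded_plane_def
    by (intro plane_code.second_countable_glue) (auto simp: euclidean_piece_def)
  moreover have "second_countable (mtop summand)"
    unfolding puncture_def open_submanifold_def
    using second_countable_subtopology[OF second_countable_M] by simp
  ultimately show "second_countable (mtop (piece k))" for k by (cases k) simp_all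
qed simp

lemma openin_base: "open W \<Longrightarrow> openin (mtop total) (base ` (plane \<inter> W))"
  by (rule signed_embedding_open[OF embedding_base]) (simp add: openin_euclidean_piece open_plane open_Int)

lemma openin_copy:
  "openin (mtop M) W \<Longrightarrow> openin (mtop total) (copy m ` ((topspace (mtop M) - {i 0}) \<inter> W))"
  by (rule signed_embedding_open[OF embedding_copy])
     (simp add: openin_summand openin_Int[OF open_summand])

lemma total_cases:
  assumes "y \<in> topspace (mtop total)"
  obtains (base) x where "x \<in> plane" "y = base x"
    | (copy) m w where "w \<in> topspace (mtop M)" "w \<noteq> i 0" "y = copy m w"
  using assms by (auto simp: topspace_total)

definition separated :: "'a \<Rightarrow> 'a \<Rightarrow> bool" where
  "separated x y \<longleftrightarrow> (\<exists>U V. openin (mtop total) U \<and> openin (mtop total) V \<and> x \<in> U \<and> y \<in> V \<and> disjnt U V)"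

lemma separatedI:
  "openin (mtop total) U \<Longrightarrow> openin (mtop total) V \<Longrightarrow> x \<in> U \<Longrightarrow> y \<in> V \<Longrightarrow> U \<inter> V = {} \<Longrightarrow> separated x y"
  unfolding separated_def disjnt_def by blast

lemma separated_sym: "separated x y \<Longrightarrow> separated y x"
  unfolding separated_def by (meson disjnt_sym)

lemma separated_base:
  assumes "a \<in> plane" "b \<in> plane" "a \<noteq> b"
  shows "separated (base a) (base b)"
proof -
  obtain U V where "open U" "open V" "a \<in> U" "b \<in> V" "U \<inter> V = {}"
    using hausdorff[OF assms(3)] by blast
  then show ?thesis
    using assms injD[OF inj_base] by (intro separatedI[OF openin_base openin_base, of U V]) auto
qed

lemma separated_copy:
  assumes "a \<in> topspace (mtop M) - {i 0}" "b \<in> topspace (mtop M) - {i 0}" "copy m a \<noteq> copy m' b"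
  shows "separated (copy m a) (copy m' b)"
proof (cases "m = m'")
  case True
  then obtain U V where "openin (mtop M) U" "openin (mtop M) V" "a \<in> U" "b \<in> V" "U \<inter> V = {}"
    using assms Hausdorff_M unfolding Hausdorff_space_def disjnt_def by (metis Diff_iff)
  then show ?thesis
    using assms True by (intro separatedI[OF openin_copy openin_copy, of U V]) (auto simp: copy_eq)
next
  case False
  then show ?thesis
    using assms by (intro separatedI[OF openin_copy openin_copy, OF openin_topspace openin_topspace])
      (auto simp: copy_eq)
qed

lemma closed_half_disc: "closedin (mtop M) (i ` cball 0 (1/2))"
proof (rule compactin_imp_closedin[OF Hausdorff_M image_compactin])
  show "continuous_map (mtop (euclidean_piece (ball 0 2))) (mtop M) i"
    by (rule signed_embedding_continuous[OF disc])
  show "compactin (mtop (euclidean_piece (ball 0 2))) (cball 0 (1/2))"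
    by (auto simp: euclidean_piece_def compactin_subtopology)
qed

text \<open>The case of two points that do not lie in a common piece. The neck exchanges the points at
  distance more than \<open>1/2\<close> from the centre with those of norm less than \<open>1/2\<close> in the disc of
  \<open>M\<close>. So the part of the plane outside the ball of radius \<open>1/2\<close> does not meet the copy of \<open>M\<close>
  without the disc of radius \<open>1/2\<close>, and the latter is open because that disc is compact.\<close>

lemma separated_base_copy:
  assumes a: "a \<in> plane" and b: "b \<in> topspace (mtop M) - {i 0}"
    and not: "base a \<notin> copy m ` (topspace (mtop M) - {i 0})" "copy m b \<notin> base ` plane"
  shows "separated (base a) (copy m b)"
proof (rule separatedI[OF openin_base openin_copy])
  let ?U = "{x. norm (x - centre m) > 1/2}" and ?V = "topspace (mtop M) - i ` cball 0 (1/2)"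
  show "open ?U" by (intro open_Collect_less continuous_intros)
  show "openin (mtop M) ?V" using closed_half_disc by (simp add: openin_diff)
  have "a - centre m \<notin> punctured_ball"
    using not(1) base_near_centre[of a m] disc_in_summand[OF neck_in, of "a - centre m"] by blast
  moreover have "a \<noteq> centre m" using a by (auto simp: plane_def)
  ultimately have "norm (a - centre m) \<ge> 1" by (auto simp: not_less)
  then show "base a \<in> base ` (plane \<inter> ?U)" using a by auto
  have "b \<notin> i ` cball 0 (1/2)"
  proof
    assume "b \<in> i ` cball 0 (1/2)"
    then obtain z where bz: "b = i z" and that: "norm z \<le> 1/2" by auto
    then have z: "z \<in> punctured_ball" using b that by auto
    have "base (neck z + centre m) = copy m b"
      using base_near_centre[of "neck z + centre m" m] neck_in[OF z] neck_neck[OF z] bz by simp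
    then show False using not(2) near_centre_in_plane[OF neck_in[OF z]] by (metis imageI)
  qed
  then show "copy m b \<in> copy m ` ((topspace (mtop M) - {i 0}) \<inter> ?V)"
    using b by (intro imageI) blast
  have False if x: "x \<in> ?U" and w: "w \<in> ?V" and eq: "base x = copy m w" for x w
  proof -
    have x': "x - centre m \<in> punctured_ball" and w': "w = i (neck (x - centre m))"
      using eq base_eq_copy by auto
    have "norm (neck (x - centre m)) \<le> 1/2" using norm_neck[OF x'] x by simp
    then show False using w w' by auto
  qed
  then show "base ` (plane \<inter> ?U) \<inter> copy m ` ((topspace (mtop M) - {i 0}) \<inter> ?V) = {}" by blast
qed

lemma Hausdorff_total: "Hausdorff_space (mtop total)"
proof -
  have mixed: "separated (base a) (copy m b)"
    if a: "a \<in> plane" and b: "b \<in> topspace (mtop M) - {i 0}" and ne: "base a \<noteq> copy m b" for a b m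
  proof (cases "base a \<in> copy m ` (topspace (mtop M) - {i 0})")
    case True
    then obtain a' where "a' \<in> topspace (mtop M) - {i 0}" "base a = copy m a'" by blast
    then show ?thesis using separated_copy[of a' b m m] b ne by simp
  next
    case False
    then show ?thesis
      using separated_base[OF a] ne separated_base_copy[OF a b False] by (metis imageE)
  qed
  have "separated x y" if "x \<in> topspace (mtop total)" "y \<in> topspace (mtop total)" "x \<noteq> y" for x y
    using that(1)
  proof (cases rule: total_cases)
    case x: (base a)
    show ?thesis using that(2)
    proof (cases rule: total_cases)
      case (base b)
      then show ?thesis using separated_base x that(3) by blast
    next
      case (copy m b)
      then show ?thesis using mixed[of a b m] x that(3) by simp
    qed
  next
    case x: (copy m a)
    show ?thesis using that(2)
    proof (cases rule: total_cases)
      case (base b)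
      then show ?thesis using mixed[of b a m] separated_sym x that(3) by simp
    next
      case (copy m' b)
      then show ?thesis using separated_copy[of a b m m'] x that(3) by simp
    qed
  qed
  then show ?thesis unfolding Hausdorff_space_def separated_def by blast
qed

lemma connected_plane: "connected plane"
  unfolding plane_def
  by (intro path_connected_imp_connected path_connected_complement_countable) (use dim in auto)

text \<open>If the plane lies in \<open>E1\<close>, then so does the neck of each copy. Filling the puncture of the
  copy by the disc, \<open>E1\<close> and \<open>E2\<close> induce a decomposition of the connected space \<open>M\<close> into
  disjoint open sets, of which the one from \<open>E1\<close> contains the disc.\<close>

lemma split_total_trivial:
  assumes E: "openin (mtop total) E1" "openin (mtop total) E2" "topspace (mtop total) \<subseteq> E1 \<union> E2"
    "E1 \<inter> E2 = {}" and plane: "base ` plane \<subseteq> E1"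
  shows "E2 = {}"
proof -
  let ?S = "topspace (mtop M) - {i 0}"
  have conn: "Q = {}" if "openin (mtop M) P" "openin (mtop M) Q" "topspace (mtop M) \<subseteq> P \<union> Q"
      "P \<inter> Q = {}" "P \<noteq> {}" for P Q
    using connected that unfolding connected_space_def by blast
  have "?S \<inter> copy m -` E2 = {}" for m
  proof (rule ccontr)
    assume ne: "?S \<inter> copy m -` E2 \<noteq> {}"
    have o: "openin (mtop M) (?S \<inter> copy m -` E)" if "openin (mtop total) E" for E
      using signed_smooth_onD(3)[OF signed_embeddingD(2)[OF embedding_copy] that]
      unfolding topspace_summand openin_summand by simp
    have o1: "openin (mtop M) (i ` ball 0 1)"
      by (rule signed_embedding_open[OF disc]) (auto simp: openin_euclidean_piece)
    have "i 0 \<in> ?S \<inter> copy m -` E1 \<union> i ` ball 0 1" by simp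
    then have nonempty: "?S \<inter> copy m -` E1 \<union> i ` ball 0 1 \<noteq> {}" by blast
    have disj: "i z \<notin> ?S \<inter> copy m -` E2" if "z \<in> ball 0 1" for z
    proof
      assume z2: "i z \<in> ?S \<inter> copy m -` E2"
      then have z: "z \<in> punctured_ball" using that by auto
      have "base (neck z + centre m) = copy m (i z)"
        using base_near_centre[of "neck z + centre m" m] neck_in[OF z] neck_neck[OF z] by simp
      then have "copy m (i z) \<in> E1" using plane near_centre_in_plane[OF neck_in[OF z]] by (metis image_subset_iff)
      then show False using z2 E(4) by auto
    qed
    have "?S \<subseteq> (?S \<inter> copy m -` E1) \<union> (?S \<inter> copy m -` E2)"
      using E(3) unfolding topspace_total by blast
    then have "topspace (mtop M) \<subseteq> (?S \<inter> copy m -` E1 \<union> i ` ball 0 1) \<union> (?S \<inter> copy m -` E2)"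
      by auto
    moreover have "(?S \<inter> copy m -` E1 \<union> i ` ball 0 1) \<inter> (?S \<inter> copy m -` E2) = {}"
    proof -
      have "i ` ball 0 1 \<inter> (?S \<inter> copy m -` E2) = {}"
      proof (intro equals0I)
        fix y assume y: "y \<in> i ` ball 0 1 \<inter> (?S \<inter> copy m -` E2)"
        then obtain z where "y = i z" "z \<in> ball 0 1" by (elim IntE imageE)
        then show False using disj[of z] y by (simp only: Int_iff simp_thms)
      qed
      then show ?thesis using E(4) by blast
    qed
    ultimately show False
      using conn[OF openin_Un[OF o[OF E(1)] o1] o[OF E(2)] _ _ nonempty] ne by metis
  qed
  then have no_copy: "copy m w \<notin> E2" if "w \<in> ?S" for m w using that by blast
  show "E2 = {}"
  proof (rule equals0I)
    fix y assume y: "y \<in> E2"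
    then have "y \<in> topspace (mtop total)" using openin_subset[OF E(2)] by blast
    then show False
    proof (cases rule: total_cases)
      case (base x)
      then show ?thesis using plane E(4) y by blast
    next
      case (copy m w)
      then show ?thesis using no_copy[of w m] y by simp
    qed
  qed
qed

text \<open>The image of the plane is connected, so it lies on one side of any decomposition.\<close>

lemma connected_total: "connected_space (mtop total)"
proof -
  have "connectedin (mtop (euclidean_piece plane)) plane"
    using connected_plane by (simp add: euclidean_piece_def connectedin_subtopology)
  then have c: "connectedin (mtop total) (base ` plane)"
    by (rule connectedin_continuous_map_image[OF signed_embedding_continuous[OF embedding_base]])
  show ?thesis
    unfolding connected_space_def
  proof (intro notI, elim exE conjE)
    fix E1 E2 assume E: "openin (mtop total) E1" "openin (mtop total) E2"
      "topspace (mtop total) \<subseteq> E1 \<union> E2" "E1 \<inter> E2 = {}" "E1 \<noteq> {}" "E2 \<noteq> {}"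
    have "base ` plane \<subseteq> E1 \<union> E2" using E(3) by (auto simp: topspace_total)
    then have "base ` plane \<subseteq> E1 \<or> base ` plane \<subseteq> E2"
      using connectedinD[OF c E(1,2)] E(4) by blast
    then show False
      using split_total_trivial[OF E(1,2)] split_total_trivial[OF E(2,1)] E(3-6) by (auto simp: Un_commute Int_commute)
  qed
qed

section \<open>The shift\<close>

text \<open>A disc around \<open>- step\<close>, the next place in the row of centres, to which no copy of \<open>M\<close> is
  attached.\<close>

definition free_disc :: "real^'n \<Rightarrow> 'a" where
  "free_disc z = base (reflect z + - step)"

text \<open>Translation by \<open>step\<close> turns a point near \<open>- step\<close> into one near \<open>centre 0\<close>, and
  \<open>centre m\<close> into \<open>centre (Suc m)\<close>.\<close>

lemma far_from_centres:
  assumes "norm (x + step) < 2"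
  shows "norm (x - centre m) \<ge> 2"
proof (rule ccontr)
  assume "\<not> norm (x - centre m) \<ge> 2"
  then have "0 = Suc m"
    using assms by (intro centre_apart[of "x + step"]) (auto simp: centre_Suc, simp add: centre_def)
  then show False by simp
qed

lemma free_disc_in_plane:
  assumes "norm z < 2" shows "reflect z + - step \<in> plane"
proof -
  have "reflect z + - step \<noteq> centre m" for m
    using far_from_centres[of "reflect z + - step" m] assms by auto
  then show ?thesis by (auto simp: plane_def)
qed

lemma minus_step_in_plane: "- step \<in> plane"
  using free_disc_in_plane[of 0] by simp

lemma total_in: "total \<in> connected_oriented_manifolds"
proof -
  have "signed_smooth_on 1 total total (topspace (mtop total)) id"
    unfolding total_def by (rule signed_smooth_on_id_glue)
  then have "oriented_smooth_manifold total"
    by (simp add: oriented_smooth_manifold_iff Hausdorff_total second_countable_total charted_total)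
  moreover have "topspace (mtop total) \<noteq> {}"
    unfolding topspace_total using minus_step_in_plane by blast
  ultimately show ?thesis
    unfolding connected_oriented_manifolds_def using connected_total by blast
qed

lemma embedding_free_disc: "signed_embedding (-1) (euclidean_piece (ball 0 2)) total free_disc"
proof -
  have E: "charted (euclidean_piece (ball 0 2 :: (real^'n) set))" "charted (euclidean_piece plane)"
    by (rule charted_euclidean_piece, simp add: open_plane)+
  have "signed_embedding (-1) (euclidean_piece (ball 0 2)) (euclidean_piece plane) (\<lambda>x. reflect x + - step)"
    using free_disc_in_plane
    by (intro signed_embedding_affine[where L' = reflect] linear_reflect open_plane)
      (auto simp: det_reflect)
  from signed_embedding_compose[OF E charted_total this embedding_base]
  have "signed_embedding (-1) (euclidean_piece (ball 0 2)) total (base \<circ> (\<lambda>x. reflect x + - step))"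
    by simp
  then show ?thesis by (simp add: free_disc_def[abs_def] o_def)
qed

lemma free_disc_0: "free_disc 0 = base (- step)"
  by (simp add: free_disc_def)

text \<open>Translation by \<open>step\<close> on the plane, and the identity from each copy of \<open>M\<close> to the next one.
  A point near a centre has both kinds of preimages; the two values agree because the copies are
  attached in the same way at all centres.\<close>

definition shift :: "'a \<Rightarrow> 'a" where
  "shift y = (SOME z. (\<exists>x. y = base x \<and> z = base (x + step)) \<or>
     (\<exists>m w. y = copy m w \<and> z = copy (Suc m) w))"

definition unshift :: "'a \<Rightarrow> 'a" where
  "unshift y = (SOME z. (\<exists>x. y = base x \<and> z = base (x + - step)) \<or>
     (\<exists>m w. y = copy (Suc m) w \<and> z = copy m w))"

lemma base_step_eq_copy: "base (x + step) = copy (Suc m) w \<longleftrightarrow> base x = copy m w"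
  by (simp add: base_eq_copy centre_Suc)

lemma base_minus_step_eq_copy: "base (x - step) = copy m w \<longleftrightarrow> base x = copy (Suc m) w"
  using base_step_eq_copy[of "x - step" m w] by simp

lemma shift_base [simp]: "shift (base x) = base (x + step)"
  and shift_copy [simp]: "shift (copy m w) = copy (Suc m) w"
  unfolding shift_def
  by (rule some_equality; auto simp: copy_eq base_step_eq_copy dest: injD[OF inj_base]; metis base_step_eq_copy)+

lemma unshift_base [simp]: "unshift (base x) = base (x + - step)"
  and unshift_copy [simp]: "unshift (copy (Suc m) w) = copy m w"
  unfolding unshift_def
  by (rule some_equality; auto simp: copy_eq base_minus_step_eq_copy dest: injD[OF inj_base]; metis base_minus_step_eq_copy)+

lemma translation_on_total:
  assumes D: "open D" "D \<subseteq> plane" "(\<lambda>x. x + c) ` D \<subseteq> plane"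
    and g: "\<And>x. g (base x) = base (x + c)"
  shows "signed_smooth_on 1 total total (base ` D) g"
proof -
  have E: "charted (euclidean_piece plane)" by (rule charted_euclidean_piece[OF open_plane])
  have inv: "inv_into plane base (base x) = x" if "x \<in> plane" for x
    using signed_embedding_inv[OF embedding_base] that by simp
  have 1: "signed_smooth_on 1 total (euclidean_piece plane) (base ` D) (inv_into plane base)"
    using signed_embedding_inv_on[OF embedding_base] D(1,2) by (simp add: openin_euclidean_piece open_plane)
  have 2: "signed_smooth_on 1 (euclidean_piece plane) (euclidean_piece plane) D (\<lambda>x. x + c)"
    by (intro signed_smooth_on_euclidean open_plane D signed_smooth_translation)
  have "signed_smooth_on (1 * 1) total (euclidean_piece plane) (base ` D) ((\<lambda>x. x + c) \<circ> inv_into plane base)"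
    by (rule signed_smooth_on_compose[OF charted_total E E 1 2]) (use D(2) inv in \<open>auto simp: subset_iff\<close>)
  then have 3: "signed_smooth_on 1 total (euclidean_piece plane) (base ` D) ((\<lambda>x. x + c) \<circ> inv_into plane base)"
    by simp
  have "signed_smooth_on (1 * 1) total total (base ` D) (base \<circ> ((\<lambda>x. x + c) \<circ> inv_into plane base))"
    by (rule signed_smooth_on_compose[OF charted_total E charted_total 3 signed_embeddingD(2)[OF embedding_base]])
       (use D(2,3) inv in \<open>auto simp: subset_iff\<close>)
  then have 4: "signed_smooth_on 1 total total (base ` D) (base \<circ> ((\<lambda>x. x + c) \<circ> inv_into plane base))"
    by simp
  show ?thesis
    by (rule signed_smooth_on_transform[OF charted_total charted_total 4])
       (use D(2) inv g in \<open>auto simp: subset_iff\<close>)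
qed

lemma copy_to_copy_on_total:
  assumes g: "\<And>w. g (copy m w) = copy m' w"
  shows "signed_smooth_on 1 total total (copy m ` topspace (mtop summand)) g"
proof -
  have "signed_smooth_on (1 * 1) total total (copy m ` topspace (mtop summand))
      (copy m' \<circ> inv_into (topspace (mtop summand)) (copy m))"
    by (rule signed_smooth_on_compose[OF charted_total charted_summand charted_total
          signed_embeddingD(3)[OF embedding_copy] signed_embeddingD(2)[OF embedding_copy]])
       (intro image_subsetI, elim imageE, simp only: inv_copy)
  then have 1: "signed_smooth_on 1 total total (copy m ` topspace (mtop summand))
      (copy m' \<circ> inv_into (topspace (mtop summand)) (copy m))" by simp
  show ?thesis
    by (rule signed_smooth_on_transform[OF charted_total charted_total 1])
       (elim imageE, simp only: inv_copy g o_apply)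
qed

lemma plane_step:
  "x \<in> plane \<Longrightarrow> x \<noteq> - step \<Longrightarrow> x + step \<in> plane"
  "x \<in> plane \<Longrightarrow> x - step \<in> plane \<and> x - step \<noteq> - step"
proof -
  have c0: "centre 0 = 0" by (simp add: centre_def)
  show "x + step \<in> plane" if "x \<in> plane" "x \<noteq> - step"
  proof -
    have "x + step \<noteq> centre m" for m
    proof (cases m)
      case 0
      then show ?thesis using that(2) c0 by (auto simp: eq_neg_iff_add_eq_0)
    next
      case (Suc k)
      then show ?thesis using that(1) by (auto simp: plane_def centre_Suc)
    qed
    then show ?thesis by (auto simp: plane_def)
  qed
  show "x - step \<in> plane \<and> x - step \<noteq> - step" if "x \<in> plane"
  proof -
    have "x \<noteq> centre (Suc m)" "x \<noteq> centre 0" for m using that by (auto simp: plane_def)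
    then show ?thesis by (auto simp: plane_def centre_Suc c0 diff_eq_eq)
  qed
qed

lemma base_minus_step_not_copy: "base (- step) \<noteq> copy m w"
  using far_from_centres[of "- step" m] by (auto simp: base_eq_copy)

lemma topspace_punctured_total:
  "topspace (mtop (puncture total (base (- step)))) =
     base ` (plane - {- step}) \<union> (\<Union>m. copy m ` topspace (mtop summand))"
proof -
  have "copy m w \<noteq> base (- step)" for m w using base_minus_step_not_copy by metis
  then show ?thesis
    by (auto simp: puncture_def topspace_total dest: injD[OF inj_base])
qed

text \<open>Translation by \<open>step\<close> maps the plane with the further puncture \<open>- step\<close> onto the plane, whose
  puncture at \<open>centre 0\<close> is the image of \<open>- step\<close>. Thus the shift embeds the infinite sum, punctured at the centre of the free disc, onto the
  infinite sum without the part of copy \<open>0\<close> beyond its neck.\<close>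

lemma embedding_shift: "signed_embedding 1 (puncture total (base (- step))) total shift"
proof -
  let ?P = "puncture total (base (- step))" and ?X = "topspace (mtop total) - {base (- step)}"
  let ?I = "base ` plane \<union> (\<Union>m. copy (Suc m) ` topspace (mtop summand))"
  have X: "openin (mtop total) ?X"
    using closedin_Hausdorff_singleton[OF Hausdorff_total, of "base (- step)"] minus_step_in_plane
    by (intro openin_diff openin_topspace) (auto simp: topspace_total)
  have tP: "topspace (mtop ?P) = ?X" by (auto simp: puncture_def)
  note X_eq = topspace_punctured_total[unfolded tP]
  have P: "charted ?P" unfolding puncture_def by (rule charted_open_submanifold[OF charted_total X])
  have im: "shift ` ?X = ?I"
  proof (intro equalityI subsetI)
    fix y assume "y \<in> shift ` ?X"
    then consider x where "x \<in> plane" "x \<noteq> - step" "y = shift (base x)"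
      | m w where "w \<in> topspace (mtop summand)" "y = shift (copy m w)"
      unfolding X_eq by blast
    then show "y \<in> ?I"
    proof cases
      case 1
      then show ?thesis using plane_step(1) by simp
    next
      case 2
      then have "y \<in> copy (Suc m) ` topspace (mtop summand)" by simp
      then show ?thesis by blast
    qed
  next
    fix y assume "y \<in> ?I"
    then consider x where "x \<in> plane" "y = base x" | m w where "w \<in> topspace (mtop summand)" "y = copy (Suc m) w"
      by blast
    then show "y \<in> shift ` ?X"
    proof cases
      case 1
      then have "y = shift (base (x - step))" by simp
      moreover have "base (x - step) \<in> ?X" unfolding X_eq using plane_step(2)[OF 1(1)] by blast
      ultimately show ?thesis by (rule image_eqI)
    next
      case 2
      then have "y = shift (copy m w)" by simp
      moreover have "copy m w \<in> ?X" unfolding X_eq using 2 by blast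
      ultimately show ?thesis by (rule image_eqI)
    qed
  qed
  have f: "signed_smooth_on 1 total total ?X shift"
  proof (rule signed_smooth_on_local[OF charted_total charted_total])
    fix y assume "y \<in> ?X"
    then consider "y \<in> base ` (plane - {- step})" | m where "y \<in> copy m ` topspace (mtop summand)"
      unfolding X_eq by blast
    then show "\<exists>W' g. y \<in> W' \<and> W' \<subseteq> ?X \<and> signed_smooth_on 1 total total W' g \<and> (\<forall>y\<in>W'. g y = shift y)"
    proof cases
      case 1
      have "signed_smooth_on 1 total total (base ` (plane - {- step})) shift"
        by (rule translation_on_total[of _ step]) (use open_plane plane_step(1) in \<open>auto intro: open_Diff\<close>)
      then show ?thesis using 1 unfolding X_eq
        by (intro exI[of _ "base ` (plane - {- step})"] exI[of _ shift] conjI) auto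
    next
      case 2
      have "signed_smooth_on 1 total total (copy m ` topspace (mtop summand)) shift"
        by (rule copy_to_copy_on_total[of _ _ "Suc m"]) simp
      then show ?thesis using 2 unfolding X_eq
        by (intro exI[of _ "copy m ` topspace (mtop summand)"] exI[of _ shift] conjI) auto
    qed
  qed
  have g: "signed_smooth_on 1 total total ?I unshift"
  proof (rule signed_smooth_on_local[OF charted_total charted_total])
    fix y assume "y \<in> ?I"
    then consider "y \<in> base ` plane" | m where "y \<in> copy (Suc m) ` topspace (mtop summand)" by blast
    then show "\<exists>W' g. y \<in> W' \<and> W' \<subseteq> ?I \<and> signed_smooth_on 1 total total W' g \<and> (\<forall>y\<in>W'. g y = unshift y)"
    proof cases
      case 1
      have "signed_smooth_on 1 total total (base ` plane) unshift"
        by (rule translation_on_total[of _ "- step"]) (use open_plane plane_step(2) in auto)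
      then show ?thesis using 1
        by (intro exI[of _ "base ` plane"] exI[of _ unshift] conjI) auto
    next
      case 2
      have "signed_smooth_on 1 total total (copy (Suc m) ` topspace (mtop summand)) unshift"
        by (rule copy_to_copy_on_total[of _ _ m]) simp
      then show ?thesis using 2
        by (intro exI[of _ "copy (Suc m) ` topspace (mtop summand)"] exI[of _ unshift] conjI) auto
    qed
  qed
  have us: "unshift (shift y) = y" if "y \<in> ?X" for y
    using that unfolding X_eq by auto
  have f': "signed_smooth_on 1 ?P total ?X shift"
    unfolding puncture_def by (rule signed_smooth_on_from_open_submanifold[OF charted_total charted_total X f]) simp
  have g': "signed_smooth_on 1 total ?P ?I unshift"
    unfolding puncture_def[of total]
  proof (rule signed_smooth_on_into_open_submanifold[OF X g])
    show "unshift ` ?I \<subseteq> ?X" unfolding im[symmetric] using us by auto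
  qed
  show ?thesis
    by (rule signed_embeddingI[OF P charted_total f'[folded tP] g'[folded im, folded tP]])
       (simp only: tP us)
qed

text \<open>Attaching \<open>M\<close> at the free disc and then shifting yields the identification that already
  exists between copy \<open>0\<close> and the plane.\<close>

lemma attached_iff:
  "attached i free_disc p q \<longleftrightarrow> (\<exists>w y. p = (False, w) \<and> q = (True, y) \<and>
     w \<in> topspace (mtop summand) \<and> y \<in> topspace (mtop (puncture total (base (- step)))) \<and> copy 0 w = shift y)"
    (is "_ \<longleftrightarrow> ?rhs")
proof
  have c0: "centre 0 = 0" by (simp add: centre_def)
  {
    assume "attached i free_disc p q"
    then obtain u t where ut: "norm u = 1" "0 < t" "t < 1" "p = (False, i (t *\<^sub>R u))"
      "q = (True, free_disc ((1 - t) *\<^sub>R u))"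
      unfolding attached_def by blast
    define z where "z = reflect ((1 - t) *\<^sub>R u)"
    have z: "z \<in> punctured_ball"
      unfolding z_def by (rule iffD2[OF reflect_punctured_ball]) (use ut in auto)
    have nz: "neck z = t *\<^sub>R u"
      unfolding neck_def z_def reflect_reflect by (rule radial_flip_scale[OF ut(1-3)])
    have z1: "z + - step \<in> plane - {- step}"
      using free_disc_in_plane[of "(1 - t) *\<^sub>R u"] ut z by (auto simp: z_def[symmetric])
    have q: "q = (True, base (z + - step))" using ut(5) by (simp add: free_disc_def z_def)
    have "base z = copy 0 (i (t *\<^sub>R u))"
      using base_near_centre[of z 0] z nz by (simp add: c0)
    then have "copy 0 (i (t *\<^sub>R u)) = shift (base (z + - step))" by simp
    moreover have "i (t *\<^sub>R u) \<in> topspace (mtop summand)"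
      using disc_in_summand[OF neck_in[OF z]] by (simp add: nz)
    moreover have "base (z + - step) \<in> topspace (mtop (puncture total (base (- step))))"
      unfolding topspace_punctured_total using z1 by blast
    ultimately show ?rhs using q ut(4) by blast
  next
    assume ?rhs
    then obtain w y where wy: "p = (False, w)" "q = (True, y)" "w \<in> topspace (mtop summand)"
      "y \<in> topspace (mtop (puncture total (base (- step))))" "copy 0 w = shift y" by blast
    then obtain x where x: "y = base x"
      unfolding topspace_punctured_total by (auto simp: copy_eq)
    define z where "z = x + step"
    have "base z = copy 0 w" using wy(5) x by (simp add: z_def)
    then have z: "z \<in> punctured_ball" "w = i (neck z)" using base_eq_copy[of z 0 w] by (auto simp: c0)
    \<comment> \<open>Polar coordinates of \<open>v\<close> provide the parameters \<open>u\<close> and \<open>1 - t\<close> of the connected sum.\<close>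
    define v where "v = reflect z"
    have v: "v \<in> punctured_ball" unfolding v_def by (rule iffD2[OF reflect_punctured_ball z(1)])
    let ?t = "1 - norm v" and ?u = "(1 / norm v) *\<^sub>R v"
    have t: "norm ?u = 1" "0 < ?t" "?t < 1" using v by auto
    have v': "(1 - ?t) *\<^sub>R ?u = v" using v by simp
    have "neck z = ?t *\<^sub>R ?u"
      using radial_flip_scale[OF t] unfolding v' by (simp add: neck_def v_def)
    moreover have "y = free_disc v" by (simp add: x free_disc_def v_def z_def)
    ultimately have "p = (False, i (?t *\<^sub>R ?u)) \<and> q = (True, free_disc ((1 - ?t) *\<^sub>R ?u))"
      using wy(1,2) z(2) v' by simp
    then show "attached i free_disc p q" unfolding attached_def using t by blast
  }
qed

text \<open>The infinite sum is covered by copy \<open>0\<close> of \<open>M\<close> and by the image of the shift, with the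
  identifications of the connected sum of \<open>M\<close> with the punctured infinite sum.\<close>

lemma absorbs: "is_connected_sum M total total"
proof -
  have b: "open (ball 0 2 :: (real^'n) set)" "cball 0 1 \<subseteq> (ball 0 2 :: (real^'n) set)" by auto
  have d: "orientation_preserving_disc M i" "orientation_reversing_disc total free_disc"
    using signed_embedding_disc(1)[OF charted_M b disc] signed_embedding_disc(2)[OF charted_total b embedding_free_disc]
    by auto
  let ?A = "\<lambda>b. if b then puncture total (free_disc 0) else puncture M (i 0)"
  let ?E = "\<lambda>b. if b then shift else copy 0"
  \<comment> \<open>\<open>?\<Psi> p\<close> is the class of points of the two summands that lie over \<open>p\<close>.\<close>
  let ?\<Psi> = "\<lambda>p. {q. snd q \<in> topspace (mtop (?A (fst q))) \<and> ?E (fst q) (snd q) = p}"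
  have emb: "signed_embedding 1 (?A b) total (?E b)" for b
    using embedding_shift embedding_copy by (simp add: free_disc_0)
  have chA: "charted (?A b)" for b
    using charted_summand charted_open_submanifold[OF charted_total openin_diff[OF openin_topspace closedin_Hausdorff_singleton[OF Hausdorff_total]]]
      minus_step_in_plane by (auto simp: free_disc_0 puncture_def topspace_total)
  have cover: "(\<Union>b. ?E b ` topspace (mtop (?A b))) = topspace (mtop total)"
  proof
    show "(\<Union>b. ?E b ` topspace (mtop (?A b))) \<subseteq> topspace (mtop total)"
      using signed_smooth_onD(2)[OF signed_embeddingD(2)[OF emb]] by blast
    show "topspace (mtop total) \<subseteq> (\<Union>b. ?E b ` topspace (mtop (?A b)))"
    proof
      fix y assume "y \<in> topspace (mtop total)"
      then show "y \<in> (\<Union>b. ?E b ` topspace (mtop (?A b)))"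
      proof (cases rule: total_cases)
        case (base x)
        then have "y = ?E True (base (x - step))" by simp
        moreover have "base (x - step) \<in> topspace (mtop (?A True))"
          using plane_step(2)[OF base(1)] by (simp add: free_disc_0 topspace_punctured_total)
        ultimately show ?thesis by blast
      next
        case (copy m w)
        show ?thesis
        proof (cases m)
          case 0
          then have "y = ?E False w" "w \<in> topspace (mtop (?A False))" using copy by auto
          then show ?thesis by blast
        next
          case (Suc k)
          then have "y = ?E True (copy k w)" using copy by simp
          moreover have "copy k w \<in> topspace (mtop (?A True))"
            using copy by (auto simp: free_disc_0 topspace_punctured_total)
          ultimately show ?thesis by blast
        qed
      qed
    qed
  qed
  have inj\<Psi>: "inj_on ?\<Psi> (topspace (mtop total))"
  proof (rule inj_onI)
    fix p p' assume p: "p \<in> topspace (mtop total)" and eq: "?\<Psi> p = ?\<Psi> p'"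
    obtain b x where "x \<in> topspace (mtop (?A b))" "p = ?E b x" using p unfolding cover[symmetric] by blast
    then have "(b, x) \<in> ?\<Psi> p" by simp
    then show "p = p'" unfolding eq using \<open>p = ?E b x\<close> by simp
  qed
  have cls: "gluing_class i free_disc (b, x) = ?\<Psi> (?E b x)" if x: "x \<in> topspace (mtop (?A b))" for b x
  proof -
    have inj: "?E b' x = ?E b' y \<longleftrightarrow> x = y" if "x \<in> topspace (mtop (?A b'))" "y \<in> topspace (mtop (?A b'))" for b' x y
      using inj_onD[OF signed_embeddingD(1)[OF emb] _ that] by blast
    have "q \<in> gluing_class i free_disc (b, x) \<longleftrightarrow> q \<in> ?\<Psi> (?E b x)" for q
    proof (cases q)
      case (Pair b' y)
      show ?thesis
        using inj[of x b y] x unfolding gluing_class_def attached_iff Pair free_disc_0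
        by (cases b; cases b') auto
    qed
    then show ?thesis by blast
  qed
  have "oriented_diffeomorphic (connected_sum_along M total i free_disc) total"
    unfolding connected_sum_along_eq_glue
    by (rule glue_embeddings[where E = ?E and \<Psi> = ?\<Psi>]) (fact chA charted_total emb cover inj\<Psi> cls)+
  then show ?thesis unfolding is_connected_sum_def using d by blast
qed

end

section \<open>The swindle\<close>

text \<open>Cardinal arithmetic: the injection \<open>p\<close> shows that the type is infinite.\<close>

lemma inj_option_times:
  assumes "inj (p :: nat \<Rightarrow> 'a)"
  shows "\<exists>J :: nat option \<times> 'a \<Rightarrow> 'a. inj J"
proof -
  have inf: "\<not> finite (UNIV :: 'a set)"
    using assms finite_imageD[of p UNIV] finite_subset[of "range p"] by auto
  have "inj (p \<circ> (to_nat :: nat option \<Rightarrow> nat))"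
    by (rule inj_compose[OF assms inj_to_nat])
  then have "(card_of (UNIV :: nat option set), card_of (UNIV :: 'a set)) \<in> ordLeq"
    by (rule card_of_ordLeqI) auto
  then have "(card_of ((UNIV :: nat option set) \<times> (UNIV :: 'a set)), card_of (UNIV :: 'a set)) \<in> ordIso"
    using card_of_Times_infinite[OF inf] by blast
  then obtain J where "bij_betw J ((UNIV :: nat option set) \<times> (UNIV :: 'a set)) (UNIV :: 'a set)"
    using card_of_ordIso by blast
  then show ?thesis by (auto simp: bij_betw_def)
qed

text \<open>A nonempty manifold of positive dimension contains a Euclidean ball and hence has room to
  encode \<open>\<real>\<^sup>n\<close> and countably many copies of itself in its own type of points.\<close>

lemma absorbing_manifold_exists:
  fixes M :: "('a, 'n::finite) atlas_space"
  assumes M: "M \<in> connected_oriented_manifolds" and dim: "CARD('n) \<ge> 2"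
  shows "\<exists>N\<in>connected_oriented_manifolds :: ('a, 'n) atlas_space set. is_connected_sum M N N"
proof -
  have M': "oriented_smooth_manifold M" "connected_space (mtop M)" "topspace (mtop M) \<noteq> {}"
    using M by (auto simp: connected_oriented_manifolds_def)
  obtain i where i: "signed_embedding 1 (euclidean_piece (ball 0 2)) M i"
    using oriented_disc_exists[OF M'(1,3)] by blast
  obtain f g where fg: "homeomorphism (ball 0 2 :: (real^'n) set) (UNIV :: (real^'n) set) f g"
    using homeomorphic_ball_UNIV[of 2 "0 :: real^'n"] unfolding homeomorphic_def by auto
  have "inj g" using fg by (metis homeomorphism_def injI UNIV_I)
  moreover have "inj_on i (range g)"
    using signed_embeddingD(1)[OF i] fg by (simp add: homeomorphism_def)
  \<comment> \<open>The points of \<open>\<real>\<^sup>n\<close> are encoded by the points of the disc.\<close>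
  ultimately have h: "inj (i \<circ> g)" by (rule comp_inj_on)
  have "inj (\<lambda>m. real m *\<^sub>R (axis undefined 1 :: real^'n))"
    by (rule injI) (simp add: axis_eq_0_iff)
  from inj_compose[OF h this] obtain J :: "nat option \<times> 'a \<Rightarrow> 'a" where "inj J"
    using inj_option_times by blast
  then interpret infinite_connected_sum M i "i \<circ> g" J
    using M' i h dim by unfold_locales
  show ?thesis using total_in absorbs by blast
qed

theorem proposition1p1:
  assumes "CARD('n::finite) \<ge> 2"
  shows "\<not> (\<exists>c :: ('a, 'n) atlas_space \<Rightarrow> 'v::ab_group_add.
      (\<exists>M\<in>connected_oriented_manifolds. c M \<noteq> 0) \<and>
      (\<forall>M\<in>connected_oriented_manifolds. \<forall>M'\<in>connected_oriented_manifolds.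
         oriented_diffeomorphic M M' \<longrightarrow> c M = c M') \<and>
      (\<forall>M\<in>connected_oriented_manifolds. \<forall>M'\<in>connected_oriented_manifolds.
         \<forall>N\<in>connected_oriented_manifolds.
         is_connected_sum M M' N \<longrightarrow> c N = c M + c M'))"
proof (intro notI, elim exE conjE)
  fix c :: "('a, 'n) atlas_space \<Rightarrow> 'v"
  assume "\<exists>M\<in>connected_oriented_manifolds. c M \<noteq> 0"
    and add: "\<forall>M\<in>connected_oriented_manifolds. \<forall>M'\<in>connected_oriented_manifolds.
         \<forall>N\<in>connected_oriented_manifolds. is_connected_sum M M' N \<longrightarrow> c N = c M + c M'"
  then obtain M where M: "M \<in> connected_oriented_manifolds" "c M \<noteq> 0" by blast
  obtain N where N: "N \<in> connected_oriented_manifolds" "is_connected_sum M N N"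
    using absorbing_manifold_exists[OF M(1) assms] by blast
  have "c N = c M + c N" using add M(1) N by blast
  then show False using M(2) by simp
qed

end
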